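(* Let $d\geq 2$, $R>0$, $\delta>0$, and let $X^{+},X^{-}\subset R\mathbb{B}_2^d$ be two $\delta$-separated sets. Define the parameters $N$ and $\gamma$ as follows: if $X^+$ and $X^-$ are finite, let $N:=|X^+|+|X^-|$ and $\gamma:=\delta^2/(8Rd)$; otherwise, assume $X^+$ and $X^-$ have $(\delta,64\delta^{-2}R^3d)$-mutual complexity $N$ and let $\gamma:=\delta^2/(16Rd)$. For $\lambda>0$ let \[ p:=\frac{R}{8(d-1)\lambda}\left(\frac{\delta^{2}}{8R^{2}}\right)^{d}\quad\text{and}\quad\mathcal{M}(\gamma,N):=\sqrt{\frac{4R(R+\gamma)}{N(1+2R/\gamma)^{2N}-N}}. \] Let $\eta\in(0,1)$, and consider the random one-layer network $\Phi:\mathbb{R}^d\to\mathbb{R}^n$, $\Phi(x)=\mathrm{ReLU}(Wx+b)$, where the bias $b\sim\mathrm{Unif}([-\lambda,\lambda]^n)$ is independent of $W$, and where the width $n$ and maximal bias $\lambda$ satisfy one of the following: (i) $n\geq \log(N/\eta)/p$ and $\lambda\geq R$, and the rows $W_1,\dots,W_n$ of $W\in\mathbb{R}^{n\times d}$ are i.i.d. uniform on the unit sphere $\mathbb{S}^{d-1}$; (ii) $n\geq 10\log(N/\eta)/p$ and $\lambda\geq 3R\sqrt d$, and $W\in\mathbb{R}^{n\times d}$ has i.i.d. $\mathcal N(0,1)$ entries. Then, with probability at least $1-\eta$, the sets $\Phi(X^+),\Phi(X^-)\subset\mathbb{R}^n$ are linearly separable with margin at least $\mathcal{M}(\gamma,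N)$.
   Context: $\|\cdot\|$ is the Euclidean norm, $\mathbb{B}_2^d(c,r)$ the closed Euclidean ball of radius $r$ centered at $c$, $R\mathbb{B}_2^d:=\mathbb{B}_2^d(0,R)$, $\mathbb{S}^{d-1}$ the unit sphere, and $\mathrm{dist}(x,S):=\inf\{\|x-y\|:y\in S\}$. $\mathrm{ReLU}(x)=\max(x,0)$ applied coordinatewise. Two sets $X^+,X^-$ are $\delta$-separated if $\|x^+-x^-\|\geq\delta$ for all $x^+\in X^+,x^-\in X^-$. Two sets $S^+,S^-\subset\mathbb{R}^n$ are linearly separable if there exist a nonzero $a\in\mathbb{R}^n$ and $c\in\mathbb{R}$ with $a^Ts+c>0$ for $s\in S^+$ and $a^Ts+c<0$ for $s\in S^-$; the margin of this hyperplane is $\inf\{|a^Ts+c|/\|a\|: s\in S^+\cup S^-\}$, and "separable with margin at least $m$" means such $a,c$ exist with margin at least $m$. Mutual complexity: two $\delta$-separated sets $X^+,X^-\subset R\mathbb{B}_2^d$ have $(\delta,\mu)$-mutual complexity $N$ if there exist finite sets of centers $C^+=\{c_i^+\}_{i=1}^{N^+}$, $C^-=\{c_j^-\}_{j=1}^{N^-}\subset\mathbb{R}^d$ with $N^++N^-=N$ and radii $r_i^+,r_j^-\geq 0$ such that: (1) $X^+\subset\bigcup_i X_i^+$ and $X^-\subset\bigcup_j X_j^-$, where $X_i^+:=X^+\cap\mathbb{B}_2^d(c_i^+,r_i^+)$, $X_j^-:=X^-\cap\mathbb{B}_2^d(c_j^-,r_j^-)$, and $c_i^+\in\mathrm{conv}(X_i^+)$,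 $c_j^-\in\mathrm{conv}(X_j^-)$ for all $i,j$; (2) $r_i^+\leq\mu^{-1}\mathrm{dist}(c_i^+,C^-)^2$ and $r_j^-\leq\mu^{-1}\mathrm{dist}(c_j^-,C^+)^2$ for all $i,j$; (3) $C^+$ and $C^-$ are $\delta$-separated. *)

theory Defs
  imports "HOL-Probability.Probability"
begin

definition delta_separated :: "real \<Rightarrow> ('a::metric_space) set \<Rightarrow> 'a set \<Rightarrow> bool" where
  "delta_separated \<delta> A B \<longleftrightarrow> (\<forall>x\<in>A. \<forall>y\<in>B. dist x y \<ge> \<delta>)"

definition lin_sep_margin :: "real \<Rightarrow> ('a::real_inner) set \<Rightarrow> 'a set \<Rightarrow> bool" where
  "lin_sep_margin m Sp Sm \<longleftrightarrow> (\<exists>a c. a \<noteq> 0 \<and>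
      (\<forall>s\<in>Sp. inner a s + c > 0) \<and> (\<forall>s\<in>Sm. inner a s + c < 0) \<and>
      (\<forall>s\<in>Sp \<union> Sm. m \<le> \<bar>inner a s + c\<bar> / norm a))"

text \<open>(delta,mu)-mutual complexity N, with indexed centres (multiplicities allowed).
  dist(c, C)^2 for a finite set C is the minimum, written as a bound against every element.\<close>
definition mutual_complexity ::
  "real \<Rightarrow> real \<Rightarrow> ('a::euclidean_space) set \<Rightarrow> 'a set \<Rightarrow> nat \<Rightarrow> bool" where
  "mutual_complexity \<delta> \<mu> Xp Xm N \<longleftrightarrow>
    (\<exists>(Np::nat) (Nm::nat) (cp::nat \<Rightarrow> 'a) (cm::nat \<Rightarrow> 'a) (rp::nat \<Rightarrow> real) (rm::nat \<Rightarrow> real).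
       Np + Nm = N \<and>
       (\<forall>i<Np. rp i \<ge> 0) \<and> (\<forall>j<Nm. rm j \<ge> 0) \<and>
       Xp \<subseteq> (\<Union>i<Np. cball (cp i) (rp i)) \<and>
       Xm \<subseteq> (\<Union>j<Nm. cball (cm j) (rm j)) \<and>
       (\<forall>i<Np. cp i \<in> convex hull (Xp \<inter> cball (cp i) (rp i))) \<and>
       (\<forall>j<Nm. cm j \<in> convex hull (Xm \<inter> cball (cm j) (rm j))) \<and>
       (\<forall>i<Np. \<forall>j<Nm. rp i \<le> (dist (cp i) (cm j))\<^sup>2 / \<mu>) \<and>
       (\<forall>j<Nm. \<forall>i<Np. rm j \<le> (dist (cm j) (cp i))\<^sup>2 / \<mu>) \<and>
       delta_separated \<delta> (cp ` {..<Np}) (cm ` {..<Nm}))"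

definition relu_layer :: "real^'d^'n \<Rightarrow> real^'n \<Rightarrow> real^'d \<Rightarrow> real^'n" where
  "relu_layer W b x = (\<chi> i. max 0 ((W *v x) $ i + b $ i))"

text \<open>Uniform distribution on the unit sphere: the normalized surface measure, realised as the
  radial projection of the uniform distribution on the unit ball.\<close>
definition unif_sphere :: "(real^'d) measure" where
  "unif_sphere = distr (uniform_measure lborel (ball 0 1)) borel (\<lambda>x. x /\<^sub>R norm x)"

definition sphere_rows :: "(real^'d^'n) measure" where
  "sphere_rows = distr (PiM UNIV (\<lambda>_::'n. unif_sphere)) borel (\<lambda>f. \<chi> i. f i)"

definition gauss_matrix :: "(real^'d^'n) measure" where
  "gauss_matrix = density lborel (\<lambda>W. ennreal (\<Prod>i\<in>UNIV. \<Prod>j\<in>UNIV. std_normal_density (W $ i $ j)))"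

definition unif_bias :: "real \<Rightarrow> (real^'n) measure" where
  "unif_bias L = uniform_measure lborel (cbox (- (L *\<^sub>R One)) (L *\<^sub>R One))"

text \<open>Event A holds with probability at least q (inner measure formulation).\<close>
definition with_prob_at_least :: "'a measure \<Rightarrow> real \<Rightarrow> 'a set \<Rightarrow> bool" where
  "with_prob_at_least P q A \<longleftrightarrow> (\<exists>E\<in>sets P. E \<subseteq> A \<and> measure P E \<ge> q)"

definition sep_event :: "real \<Rightarrow> (real^'d) set \<Rightarrow> (real^'d) set \<Rightarrow> ((real^'d^'n) \<times> (real^'n)) set" where
  "sep_event m Xp Xm = {(W, b). lin_sep_margin m (relu_layer W b ` Xp) (relu_layer W b ` Xm)}"

definition margin_M :: "real \<Rightarrow> real \<Rightarrow> nat \<Rightarrow> real" where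
  "margin_M R \<gamma> N = sqrt (4 * R * (R + \<gamma>) / (real N * (1 + 2 * R / \<gamma>) ^ (2 * N) - real N))"

end

theory Submission
  imports Defs
begin

text \<open>
  Cover both classes by balls around \<open>N\<close> centres and order the centres by decreasing norm. Write
  \<open>s = \<delta> / (2R)\<close> and let \<open>x\<close> be a centre. Every centre \<open>y\<close> of the other class with
  \<open>norm y \<le> norm x\<close> satisfies \<open>x \<bullet> (x - y) \<ge> (dist x y)\<^sup>2 / 2\<close>, so a weight vector \<open>w\<close> in
  the cone around \<open>x\<close> whose half-angle has sine \<open>(1 - 1/d) s\<close> satisfies
  \<open>w \<bullet> x \<ge> w \<bullet> y + norm w * (2 R s\<^sup>2 / d)\<close>. Hence there is an interval of biases of length
  proportional to \<open>R s\<^sup>2 / d\<close> for which the neuron has activation at least \<open>\<gamma> * norm w\<close> on the ball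
  around \<open>x\<close> and vanishes on all later balls of the other class. An ellipsoid inscribed in the cone
  bounds the probability of such a \<open>w\<close> from below, so one neuron is good for \<open>x\<close> with probability
  at least \<open>p\<close> (\<open>p / 10\<close> in the Gaussian case, which reduces to the spherical one because the Gaussian
  density is radial), and a union bound over the centres gives a good neuron for each of them.

  The output weights \<open>\<plusminus> q ^ (N - 1 - k)\<close> with \<open>q = 1 + 2R/\<gamma>\<close>, divided by the norm of the weight
  vector, then separate: neurons of earlier centres do not hurt, and the geometric growth dominates
  the later ones, each of which contributes at most \<open>2R\<close>. One neuron may serve several centres, which
  costs the factor \<open>sqrt N\<close> in the margin.
\<close>

section \<open>Lebesgue measure on vectors\<close>

lemma measurable_vec_lambda:
  "(\<lambda>f. \<chi> i. f i) \<in> (\<Pi>\<^sub>M i\<in>(UNIV::'n::finite set). (borel :: 'a::euclidean_space measure)) \<rightarrow>\<^sub>M borel"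
proof (subst borel_measurable_euclidean_space, intro ballI)
  fix b :: "'a^'n" assume "b \<in> Basis"
  then obtain i v where b: "b = axis i v" "v \<in> Basis" by (auto simp: Basis_vec_def)
  have "(\<lambda>f. f i \<bullet> v) \<in> (\<Pi>\<^sub>M i\<in>(UNIV::'n::finite set). (borel :: 'a::euclidean_space measure)) \<rightarrow>\<^sub>M borel"
    by measurable
  then show "(\<lambda>f. (\<chi> i. f i) \<bullet> b) \<in> (\<Pi>\<^sub>M i\<in>(UNIV::'n::finite set). (borel :: 'a::euclidean_space measure)) \<rightarrow>\<^sub>M borel"
    by (simp add: b inner_axis)
qed

lemma prod_Basis_vec:
  fixes h :: "'a::euclidean_space^'n \<Rightarrow> 'b::comm_monoid_mult"
  shows "(\<Prod>b\<in>Basis. h b) = (\<Prod>i\<in>UNIV. \<Prod>v\<in>Basis. h (axis i v))"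
proof -
  have "inj_on (\<lambda>(i, v). axis i v) ((UNIV::'n set) \<times> (Basis::'a set))"
    using nonzero_Basis by (auto simp: inj_on_def axis_eq_axis)
  moreover have "(\<lambda>(i, v). axis i v) ` ((UNIV::'n set) \<times> (Basis::'a set)) = Basis"
    by (auto simp: Basis_vec_def)
  ultimately have "(\<Prod>b\<in>Basis. h b) = (\<Prod>(i,v)\<in>(UNIV::'n set) \<times> (Basis::'a set). h (axis i v))"
    by (subst (1) prod.reindex_bij_betw[symmetric, where S="(UNIV::'n set) \<times> (Basis::'a set)" and h="\<lambda>(i, v). axis i v"])
       (auto simp: bij_betw_def case_prod_unfold)
  then show ?thesis by (simp add: prod.cartesian_product)
qed

text \<open>A box of vectors is a product of boxes of components, so the two measures agree on
  boxes. The component type stays general because it will be \<open>real\<close> for rows and biases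
  and \<open>real^'d\<close> for matrices.\<close>

lemma lborel_vec_eq_PiM:
  "(lborel :: ('a::euclidean_space^'n) measure) = distr (\<Pi>\<^sub>M i\<in>UNIV. lborel) borel (\<lambda>f. \<chi> i. f i)"
proof (rule lborel_eqI)
  interpret product_sigma_finite "\<lambda>_::'n. (lborel :: 'a measure)" ..
  have [measurable]: "(\<lambda>f. \<chi> i. f i) \<in> (\<Pi>\<^sub>M i\<in>(UNIV::'n set). (lborel :: 'a measure)) \<rightarrow>\<^sub>M borel"
    using measurable_vec_lambda by (simp cong: measurable_cong_sets sets_PiM_cong)
  fix l u :: "'a^'n" assume le: "\<And>b. b \<in> Basis \<Longrightarrow> l \<bullet> b \<le> u \<bullet> b"
  have le': "l $ i \<bullet> b \<le> u $ i \<bullet> b" if "b \<in> Basis" for i b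
    using le[of "axis i b"] that by (simp add: inner_axis)
  have "(\<lambda>f. \<chi> i. f i) -` box l u \<inter> space (\<Pi>\<^sub>M i\<in>(UNIV::'n set). (lborel :: 'a measure))
      = (\<Pi>\<^sub>E i\<in>UNIV. box (l $ i) (u $ i))"
    by (auto simp: mem_box Basis_vec_def inner_axis space_PiM PiE_def Pi_def)
  then have "emeasure (distr (\<Pi>\<^sub>M i\<in>(UNIV::'n set). lborel) borel (\<lambda>f. \<chi> i. f i)) (box l u)
      = (\<Prod>i\<in>UNIV. emeasure lborel (box (l $ i) (u $ i)))"
    by (simp add: emeasure_distr emeasure_PiM)
  also have "\<dots> = (\<Prod>i\<in>UNIV. ennreal (\<Prod>b\<in>Basis. (u $ i - l $ i) \<bullet> b))"
    using le' by (intro prod.cong refl emeasure_lborel_box) auto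
  also have "\<dots> = ennreal (\<Prod>i\<in>UNIV. \<Prod>b\<in>Basis. (u $ i - l $ i) \<bullet> b)"
    using le' by (intro prod_ennreal prod_nonneg) (auto simp: inner_diff_left)
  also have "\<dots> = ennreal (\<Prod>b\<in>Basis. (u - l) \<bullet> b)"
    by (simp add: prod_Basis_vec inner_axis)
  finally show "emeasure (distr (\<Pi>\<^sub>M i\<in>(UNIV::'n set). lborel) borel (\<lambda>f. \<chi> i. f i)) (box l u)
      = ennreal (\<Prod>b\<in>Basis. (u - l) \<bullet> b)" .
qed simp

lemma nn_integral_lborel_vec_prod:
  fixes f :: "'n::finite \<Rightarrow> 'a::euclidean_space \<Rightarrow> ennreal"
  assumes [measurable]: "\<And>i. f i \<in> borel_measurable borel"
  shows "(\<integral>\<^sup>+x. (\<Prod>i\<in>UNIV. f i (x $ i)) \<partial>(lborel :: ('a^'n) measure)) = (\<Prod>i\<in>UNIV. \<integral>\<^sup>+y. f i y \<partial>lborel)"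
proof -
  interpret product_sigma_finite "\<lambda>_::'n. (lborel :: 'a measure)" ..
  have [measurable]: "(\<lambda>f. \<chi> i. f i) \<in> (\<Pi>\<^sub>M i\<in>(UNIV::'n set). (lborel :: 'a measure)) \<rightarrow>\<^sub>M borel"
    using measurable_vec_lambda by (simp cong: measurable_cong_sets sets_PiM_cong)
  have [measurable]: "(\<lambda>x::'a^'n. f i (x $ i)) \<in> borel_measurable borel" for i
    by (rule measurable_compose[OF _ assms])
       (intro borel_measurable_continuous_onI continuous_intros)
  show ?thesis
    by (subst lborel_vec_eq_PiM) (simp add: nn_integral_distr product_nn_integral_prod)
qed

section \<open>Rotation invariance of Lebesgue measure\<close>

lemma borel_measurable_linear:
  fixes f :: "'a::euclidean_space \<Rightarrow> 'b::euclidean_space"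
  assumes "linear f" shows "f \<in> borel_measurable borel"
  using assms by (intro borel_measurable_continuous_onI linear_continuous_on) (simp add: linear_conv_bounded_linear)

text \<open>Uniqueness of translation-invariant measures: for two of them, Fubini applied to
  \<open>indicator A x * indicator B (x + y)\<close> gives \<open>\<mu> A * \<nu> B = \<mu> B * \<nu> A\<close>.\<close>
lemma distr_lborel_orthogonal:
  fixes f :: "'a::euclidean_space \<Rightarrow> 'a"
  assumes f: "orthogonal_transformation f"
  shows "distr lborel borel f = lborel"
proof (rule measure_eqI)
  have lin: "linear f" using f by (rule orthogonal_transformation_linear)
  have [measurable]: "f \<in> borel \<rightarrow>\<^sub>M borel"
    using lin by (rule borel_measurable_linear)
  define \<mu> where "\<mu> = distr lborel borel f"
  have sets_\<mu>[measurable_cong, simp]: "sets \<mu> = sets borel" by (simp add: \<mu>_def)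
  have surj: "surj f" using f by (rule orthogonal_transformation_surj)
  have normf: "norm (f x) = norm x" for x using f by (rule orthogonal_transformation_norm)
  \<comment> \<open>Needed for Fubini. Since \<open>f\<close> preserves norms, centred balls are
    their own preimages and keep their finite volume.\<close>
  have sf: "sigma_finite_measure \<mu>"
  proof
    show "\<exists>A. countable A \<and> A \<subseteq> sets \<mu> \<and> \<Union> A = space \<mu> \<and> (\<forall>a\<in>A. emeasure \<mu> a \<noteq> \<infinity>)"
    proof (intro exI conjI ballI)
      show "countable (range (\<lambda>n::nat. ball (0::'a) (real n)))" by simp
      show "\<Union> (range (\<lambda>n::nat. ball (0::'a) (real n))) = space \<mu>"
        by (auto simp: \<mu>_def intro: reals_Archimedean2)
      fix a assume "a \<in> range (\<lambda>n::nat. ball (0::'a) (real n))"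
      then obtain n :: nat where a: "a = ball 0 (real n)" by auto
      have "f -` ball 0 (real n) = ball 0 (real n)" by (auto simp: normf)
      then show "emeasure \<mu> a \<noteq> \<infinity>"
        using emeasure_lborel_ball_finite[of "0::'a" "real n"] by (simp add: \<mu>_def a emeasure_distr)
    qed auto
  qed
  interpret pair_sigma_finite \<mu> "lborel :: 'a measure"
    using sf lborel.sigma_finite_measure_axioms by (simp add: pair_sigma_finite_def)
  have inv\<mu>: "(\<integral>\<^sup>+x. g (x + y) \<partial>\<mu>) = (\<integral>\<^sup>+x. g x \<partial>\<mu>)" if [measurable]: "g \<in> borel_measurable borel" for g :: "'a \<Rightarrow> ennreal" and y
  proof -
    obtain z where y: "y = f z" using surj by auto
    have "(\<integral>\<^sup>+x. g (x + y) \<partial>\<mu>) = (\<integral>\<^sup>+x. g (f (z + x)) \<partial>lborel)"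
      by (simp add: \<mu>_def nn_integral_distr y linear_add[OF lin] add.commute)
    also have "\<dots> = (\<integral>\<^sup>+x. g (f x) \<partial>distr lborel borel ((+) z))"
      by (simp add: nn_integral_distr)
    also have "\<dots> = (\<integral>\<^sup>+x. g x \<partial>\<mu>)"
      by (simp add: lborel_distr_plus \<mu>_def nn_integral_distr)
    finally show ?thesis .
  qed
  have inv_lborel: "(\<integral>\<^sup>+y. g (y + x) \<partial>lborel) = (\<integral>\<^sup>+y. g y \<partial>lborel)" if [measurable]: "g \<in> borel_measurable borel" for g :: "'a \<Rightarrow> ennreal" and x
    using nn_integral_distr[of "(+) x" lborel borel g] by (simp add: lborel_distr_plus add.commute)
  have refl_lborel: "(\<integral>\<^sup>+y. g (x - y) \<partial>lborel) = (\<integral>\<^sup>+y. g y \<partial>lborel)" if [measurable]: "g \<in> borel_measurable borel" for g :: "'a \<Rightarrow> ennreal" and x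
    by (subst (2) lborel_affine[of "-1" x]) (simp_all add: nn_integral_density nn_integral_distr)
  have key: "emeasure \<mu> A * emeasure lborel B = emeasure \<mu> B * emeasure lborel A"
    if [measurable]: "A \<in> sets borel" "B \<in> sets borel" for A B
  proof -
    have "emeasure \<mu> A * emeasure lborel B = (\<integral>\<^sup>+x. (indicator A x * (\<integral>\<^sup>+y. indicator B y \<partial>lborel)) \<partial>\<mu>)"
      by (simp add: nn_integral_multc)
    also have "\<dots> = (\<integral>\<^sup>+x. (indicator A x * (\<integral>\<^sup>+y. indicator B (y + x) \<partial>lborel)) \<partial>\<mu>)"
      by (subst inv_lborel) simp_all
    also have "\<dots> = (\<integral>\<^sup>+x. (\<integral>\<^sup>+y. indicator A x * indicator B (y + x) \<partial>lborel) \<partial>\<mu>)"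
      by (simp add: nn_integral_cmult)
    also have "\<dots> = (\<integral>\<^sup>+y. (\<integral>\<^sup>+x. indicator A x * indicator B (y + x) \<partial>\<mu>) \<partial>lborel)"
      by (rule Fubini'[symmetric]) measurable
    also have "\<dots> = (\<integral>\<^sup>+y. (\<integral>\<^sup>+x. indicator A (x - y) * indicator B x \<partial>\<mu>) \<partial>lborel)"
      using inv\<mu>[of "\<lambda>x. indicator A (x - y) * indicator B x" y for y] by (simp add: add.commute)
    also have "\<dots> = (\<integral>\<^sup>+x. (\<integral>\<^sup>+y. indicator A (x - y) * indicator B x \<partial>lborel) \<partial>\<mu>)"
      by (rule Fubini') measurable
    also have "\<dots> = (\<integral>\<^sup>+x. indicator B x * (\<integral>\<^sup>+y. indicator A (x - y) \<partial>lborel) \<partial>\<mu>)"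
      by (simp add: nn_integral_cmult mult.commute[of "indicator A _"])
    also have "\<dots> = (\<integral>\<^sup>+x. indicator B x * emeasure lborel A \<partial>\<mu>)"
      by (subst refl_lborel) simp_all
    also have "\<dots> = emeasure \<mu> B * emeasure lborel A"
      by (simp add: nn_integral_multc)
    finally show ?thesis .
  qed
  have vol: "\<not> unit_ball_vol (real DIM('a)) \<le> 0"
    using unit_ball_vol_pos[of "real DIM('a)"] by (metis not_le of_nat_0_le_iff)
  fix A assume "A \<in> sets (distr lborel borel f)"
  then have A: "A \<in> sets borel" by simp
  \<comment> \<open>The unit ball is the reference set \<open>B\<close> in \<open>key\<close>: both
    measures give it the same value, neither zero nor infinite, which therefore cancels.\<close>
  have "f -` ball 0 1 = ball 0 1" by (auto simp: normf)
  then have "emeasure \<mu> (ball 0 1) = emeasure lborel (ball (0::'a) 1)"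
    by (simp add: \<mu>_def emeasure_distr)
  moreover have "emeasure lborel (ball (0::'a) 1) \<noteq> 0" "emeasure lborel (ball (0::'a) 1) \<noteq> \<infinity>"
    using emeasure_lborel_ball_finite[of "0::'a" 1] vol by (auto simp: emeasure_ball ennreal_eq_0_iff)
  ultimately show "emeasure (distr lborel borel f) A = emeasure lborel A"
    using key[OF A, of "ball 0 1"] unfolding \<mu>_def
    by (metis ennreal_mult_cancel_left mult.commute infinity_ennreal_def borel_open open_ball)
qed simp

section \<open>Circular cones\<close>

text \<open>The parameter \<open>t\<close> is the sine of the half-angle.\<close>
definition circ_cone :: "'a::real_inner \<Rightarrow> real \<Rightarrow> 'a set" where
  "circ_cone u t = {w. sqrt (1 - t\<^sup>2) * norm w \<le> u \<bullet> w}"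

lemma sets_borel_circ_cone [measurable]: "circ_cone u t \<in> sets (borel :: 'a::euclidean_space measure)"
  unfolding circ_cone_def by measurable

text \<open>The cone contains the ellipsoid centred at \<open>2/3\<close> of its axis with semi-axes
  \<open>1/3\<close> along the axis and \<open>t/2\<close> orthogonal to it.\<close>
lemma measure_circ_cone_axis_ge:
  fixes k :: "'d::finite"
  assumes t: "0 < t" "t \<le> 1"
  shows "1/3 * (t/2) ^ (CARD('d) - 1) * measure lborel (ball (0::real^'d) 1)
       \<le> measure lborel (circ_cone (axis k 1) t \<inter> ball (0::real^'d) 1)"
proof -
  define m where "m i = (if i = k then 1/3 else t/2)" for i
  define D where "D x = (\<chi> i. m i * x $ i)" for x :: "real^'d"
  define E where "E = (+) (axis k (2/3)) ` D ` ball (0::real^'d) 1"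
  have norm_sq: "(norm v)\<^sup>2 = (v $ k)\<^sup>2 + (\<Sum>i\<in>UNIV - {k}. (v $ i)\<^sup>2)" for v :: "real^'d"
    by (simp add: norm_vec_def L2_set_def sum_nonneg sum.remove[of _ k])
  have sub: "E \<subseteq> circ_cone (axis k 1) t \<inter> ball 0 1"
  proof
    fix v assume "v \<in> E"
    then obtain x where x: "norm x < 1" and v: "v = axis k (2/3) + D x"
      by (auto simp: E_def)
    define \<xi> where "\<xi> = x $ k"
    define P where "P = (\<Sum>i\<in>UNIV - {k}. (x $ i)\<^sup>2)"
    have P0: "P \<ge> 0" by (simp add: P_def sum_nonneg)
    have "(norm x)\<^sup>2 < 1" using x by (simp add: power_less_one_iff)
    then have P: "\<xi>\<^sup>2 + P < 1" by (simp add: norm_sq P_def \<xi>_def)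
    then have "\<xi>\<^sup>2 < 1" using P0 by linarith
    then have \<xi>: "-1 < \<xi>" "\<xi> < 1" by (auto simp: abs_square_less_1)
    have vk: "v $ k = (2 + \<xi>) / 3" by (simp add: v D_def m_def \<xi>_def)
    have "(\<Sum>i\<in>UNIV - {k}. (v $ i)\<^sup>2) = (\<Sum>i\<in>UNIV - {k}. (t/2)\<^sup>2 * (x $ i)\<^sup>2)"
      by (intro sum.cong refl) (auto simp: v D_def m_def axis_def power_mult_distrib power_divide)
    then have nv: "(norm v)\<^sup>2 = ((2 + \<xi>) / 3)\<^sup>2 + (t/2)\<^sup>2 * P"
      by (simp add: norm_sq vk P_def sum_distrib_left)
    have t2: "t\<^sup>2 \<le> 1" using t by (simp add: power_le_one)
    have tP: "t\<^sup>2 * P \<le> P" using t2 P0 mult_right_mono by fastforce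
    \<comment> \<open>Slack of the norm bound: replacing \<open>t\<^sup>2 * P\<close> by its upper
      bound \<open>1 - \<xi>\<^sup>2\<close> leaves \<open>1 - (norm v)\<^sup>2\<close> at least
      this product divided by 36.\<close>
    have pos: "0 < (1 - \<xi>) * (11 - 5 * \<xi>)" using \<xi> by (intro mult_pos_pos) auto
    have "((2 + \<xi>) / 3)\<^sup>2 + (t/2)\<^sup>2 * P < 1"
    proof -
      have "0 < 11 - 16 * \<xi> + 5 * \<xi>\<^sup>2" using pos by (simp add: power2_eq_square algebra_simps)
      have "((2 + \<xi>) / 3)\<^sup>2 = (4 + 4 * \<xi> + \<xi>\<^sup>2) / 9" "(t/2)\<^sup>2 * P = t\<^sup>2 * P / 4"
        by (simp_all add: power2_eq_square field_simps)
      moreover have "(4 + 4 * \<xi> + \<xi>\<^sup>2) / 9 + t\<^sup>2 * P / 4 < 1"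
        using tP P \<open>0 < 11 - 16 * \<xi> + 5 * \<xi>\<^sup>2\<close> by argo
      ultimately show ?thesis by (simp only:)
    qed
    then have "(norm v)\<^sup>2 < 1" by (simp add: nv)
    then have ball: "v \<in> ball 0 1" by (simp add: abs_square_less_1)
    \<comment> \<open>A completed square: the sum is
      \<open>13 * (13 * \<xi>\<^sup>2 + 16 * \<xi> + 7)\<close>, and the last bracket is 36 times
      the difference of \<open>((2 + \<xi>) / 3)\<^sup>2\<close> and
      \<open>(1 - \<xi>\<^sup>2) / 4\<close>.\<close>
    have "0 < (13 * \<xi> + 8)\<^sup>2 + 27" by (intro add_nonneg_pos) auto
    then have q: "P / 4 \<le> ((2 + \<xi>) / 3)\<^sup>2"
    proof -
      have "((2 + \<xi>) / 3)\<^sup>2 = (4 + 4 * \<xi> + \<xi>\<^sup>2) / 9"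
        by (simp add: power2_eq_square field_simps)
      moreover have "(13 * \<xi> + 8)\<^sup>2 = 169 * \<xi>\<^sup>2 + 208 * \<xi> + 64" by (simp add: power2_eq_square algebra_simps)
      moreover from this have "0 < 169 * \<xi>\<^sup>2 + 208 * \<xi> + 91"
        using \<open>0 < (13 * \<xi> + 8)\<^sup>2 + 27\<close> by simp
      then have "P / 4 \<le> (4 + 4 * \<xi> + \<xi>\<^sup>2) / 9" using P by argo
      ultimately show ?thesis by (simp only:)
    qed
    have "(1 - t\<^sup>2) * (norm v)\<^sup>2 \<le> ((2 + \<xi>) / 3)\<^sup>2"
    proof -
      have "(1 - t\<^sup>2) * (P / 4) \<le> P / 4" using P0 by (simp add: algebra_simps)
      then have "t\<^sup>2 * ((1 - t\<^sup>2) * (P / 4)) \<le> t\<^sup>2 * ((2 + \<xi>) / 3)\<^sup>2"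
        using q by (intro mult_left_mono) auto
      moreover have "(1 - t\<^sup>2) * (V + (t/2)\<^sup>2 * P) = V + (t\<^sup>2 * ((1 - t\<^sup>2) * (P / 4)) - t\<^sup>2 * V)" for V
        by (simp add: power2_eq_square field_simps)
      ultimately show ?thesis by (simp add: nv)
    qed
    then have "(sqrt (1 - t\<^sup>2) * norm v)\<^sup>2 \<le> ((2 + \<xi>) / 3)\<^sup>2"
      using t2 by (simp add: power_mult_distrib)
    then have "sqrt (1 - t\<^sup>2) * norm v \<le> (2 + \<xi>) / 3"
      by (rule power2_le_imp_le) (use \<xi> in auto)
    then show "v \<in> circ_cone (axis k 1) t \<inter> ball 0 1"
      using ball by (simp add: circ_cone_def vk inner_axis')
  qed
  \<comment> \<open>The volume of \<open>E\<close> is computed in \<open>lebesgue\<close>, where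
    stretching multiplies it by the product of the entries; \<open>measure_completion\<close>
    returns to \<open>lborel\<close> at the end.\<close>
  have lm: "ball (0::real^'d) 1 \<in> lmeasurable" by simp
  have Elm: "E \<in> lmeasurable"
    unfolding E_def D_def by (intro measurable_translation measurable_stretch lm)
  have pm: "prod m UNIV = 1/3 * (t/2) ^ (CARD('d) - 1)"
  proof -
    have "prod m UNIV = m k * (\<Prod>i\<in>UNIV - {k}. m i)" by (simp add: prod.remove[of _ k])
    also have "(\<Prod>i\<in>UNIV - {k}. m i) = (\<Prod>i\<in>UNIV - {k}. t/2)"
      by (intro prod.cong) (auto simp: m_def)
    finally show ?thesis by (simp add: m_def card_Diff_singleton)
  qed
  have "\<bar>prod m UNIV\<bar> = 1/3 * (t/2) ^ (CARD('d) - 1)" unfolding pm using t by simp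
  then have "measure lebesgue E = 1/3 * (t/2) ^ (CARD('d) - 1) * measure lebesgue (ball (0::real^'d) 1)"
    unfolding E_def D_def by (simp only: measure_translation measure_stretch[OF lm])
  moreover have "measure lebesgue E \<le> measure lebesgue (circ_cone (axis k 1) t \<inter> ball (0::real^'d) 1)"
  proof (rule measure_mono_fmeasurable[OF sub])
    show "E \<in> sets lebesgue" using Elm by (rule fmeasurableD)
    have "circ_cone (axis k 1) t \<in> sets (lebesgue :: (real^'d) measure)"
      by (rule sets_completionI_sets) simp
    then show "circ_cone (axis k 1) t \<inter> ball (0::real^'d) 1 \<in> lmeasurable"
      by (metis Int_commute fmeasurable_Int_fmeasurable lm)
  qed
  ultimately show ?thesis
    by (simp add: measure_completion)
qed

text \<open>A rotation taking a coordinate axis to \<open>u\<close> carries over the axis case, as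
  it preserves the unit ball and Lebesgue measure.\<close>

lemma measure_circ_cone_ge:
  fixes u :: "real^'d"
  assumes t: "0 < t" "t \<le> 1" and u: "norm u = 1"
  shows "1/3 * (t/2) ^ (CARD('d) - 1) * measure lborel (ball (0::real^'d) 1)
       \<le> measure lborel (circ_cone u t \<inter> ball 0 1)"
proof -
  obtain k :: 'd where True by simp
  show ?thesis
  proof (rule orthogonal_transformation_exists[of "axis k 1 :: real^'d" u])
    show "norm (axis k 1 :: real^'d) = norm u" using u by simp
    fix f :: "real^'d \<Rightarrow> real^'d" assume f: "orthogonal_transformation f" "f (axis k 1) = u"
    have [measurable]: "f \<in> borel \<rightarrow>\<^sub>M borel"
      using orthogonal_transformation_linear[OF f(1)] by (rule borel_measurable_linear)
    have "f -` (circ_cone u t \<inter> ball 0 1) = circ_cone (axis k 1) t \<inter> ball 0 1"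
    proof -
      have "norm (f x) = norm x" "f (axis k 1) \<bullet> f x = axis k 1 \<bullet> x" for x
        using f(1) orthogonal_transformation_norm by (auto simp: orthogonal_transformation_def)
      then show ?thesis by (simp add: circ_cone_def set_eq_iff f(2))
    qed
    then have "measure (distr lborel borel f) (circ_cone u t \<inter> ball 0 1)
             = measure lborel (circ_cone (axis k 1) t \<inter> ball (0::real^'d) 1)"
      by (subst measure_distr) auto
    then show ?thesis
      using measure_circ_cone_axis_ge[OF t, of k] distr_lborel_orthogonal[OF f(1)] by simp
  qed
qed

section \<open>Scaling and radial integration on cones\<close>

lemma mem_circ_cone_scaleR:
  assumes "c > 0"
  shows "c *\<^sub>R w \<in> circ_cone u t \<longleftrightarrow> w \<in> circ_cone u t"
  using assms by (simp add: circ_cone_def mult.left_commute)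

lemma emeasure_circ_cone_ball:
  fixes u :: "real^'d"
  assumes "r > 0"
  shows "emeasure lborel (circ_cone u t \<inter> ball 0 r) = ennreal (r ^ CARD('d)) * emeasure lborel (circ_cone u t \<inter> ball 0 1)"
proof -
  have "(\<lambda>x. r *\<^sub>R x + 0) ` (circ_cone u t \<inter> ball 0 1) = circ_cone u t \<inter> ball 0 r"
  proof (intro equalityI subsetI)
    fix x assume "x \<in> circ_cone u t \<inter> ball 0 r"
    then have "x /\<^sub>R r \<in> circ_cone u t \<inter> ball 0 1" "x = r *\<^sub>R (x /\<^sub>R r) + 0"
      using assms by (auto simp: mem_circ_cone_scaleR field_simps)
    then show "x \<in> (\<lambda>x. r *\<^sub>R x + 0) ` (circ_cone u t \<inter> ball 0 1)" by (rule rev_image_eqI)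
  qed (use assms in \<open>auto simp: mem_circ_cone_scaleR\<close>)
  then show ?thesis
    using emeasure_lebesgue_affine[of r 0 "circ_cone u t \<inter> ball 0 1"] assms
    by (simp add: ennreal_power[symmetric])
qed

text \<open>By scaling, the cone takes the same share \<open>\<kappa>\<close> of every centred ball.
  So the law of the norm on the cone is \<open>\<kappa>\<close> times its law on the whole space,
  and every radial density inherits the share. This transfers the volume bound to Gaussian
  rows.\<close>

lemma nn_integral_circ_cone_radial:
  fixes u :: "real^'d" and F :: "real \<Rightarrow> ennreal"
  assumes [measurable]: "F \<in> borel_measurable borel"
    and \<kappa>: "emeasure lborel (circ_cone u t \<inter> ball 0 1) = \<kappa> * emeasure lborel (ball (0::real^'d) 1)"
  shows "(\<integral>\<^sup>+x. indicator (circ_cone u t) x * F (norm x) \<partial>lborel) = \<kappa> * (\<integral>\<^sup>+x. F (norm (x::real^'d)) \<partial>lborel)"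
proof -
  define M1 where "M1 = distr (density lborel (indicator (circ_cone u t))) borel norm"
  define M2 where "M2 = distr (density lborel (\<lambda>_::real^'d. \<kappa>)) borel norm"
  have vim: "norm -` {..<r} = ball (0::real^'d) r" for r by auto
  have M1: "emeasure M1 {..<r} = emeasure lborel (circ_cone u t \<inter> ball 0 r)" for r
    by (simp add: M1_def emeasure_distr vim emeasure_density indicator_inter_arith[symmetric])
  have M2: "emeasure M2 {..<r} = \<kappa> * emeasure lborel (ball (0::real^'d) r)" for r
    by (simp add: M2_def emeasure_distr vim emeasure_density_const)
  have "M1 = M2"
  proof (rule measure_eqI_generator_eq)
    show "Int_stable (range (lessThan :: real \<Rightarrow> _))"
      by (force simp: Int_stable_def greaterThan_Int_greaterThan)
    show "sets M1 = sigma_sets UNIV (range lessThan)" "sets M2 = sigma_sets UNIV (range lessThan)"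
      by (auto simp: M1_def M2_def borel_eq_lessThan eucl_lessThan)
    show "range (\<lambda>n. {..<real n}) \<subseteq> range lessThan" by auto
    show "(\<Union>n. {..<real n}) = UNIV" by (auto intro: reals_Archimedean2)
    have "emeasure lborel (circ_cone u t \<inter> ball 0 r) \<le> emeasure lborel (ball (0::real^'d) r)" for r
      by (intro emeasure_mono) auto
    then show "emeasure M1 {..<real n} \<noteq> \<infinity>" for n
      using emeasure_lborel_ball_finite[of "0::real^'d" "real n"] unfolding M1
      by (metis infinity_ennreal_def linorder_not_less)
    fix X :: "real set" assume "X \<in> range lessThan"
    then obtain r where X: "X = {..<r}" by auto
    show "emeasure M1 X = emeasure M2 X"
    proof (cases "r > 0")
      case True
      have "emeasure lborel (ball (0::real^'d) r) = ennreal (r ^ CARD('d)) * emeasure lborel (ball (0::real^'d) 1)"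
        using True by (simp add: emeasure_ball mult.commute ennreal_mult')
      then show ?thesis
        using True by (simp add: X M1 M2 emeasure_circ_cone_ball \<kappa> mult.left_commute)
    next
      case False
      then have "ball (0::real^'d) r = {}" by simp
      then show ?thesis unfolding X M1 M2 by (simp only: Int_empty_right emeasure_empty mult_zero_right)
    qed
  qed auto
  then have "integral\<^sup>N M1 F = integral\<^sup>N M2 F" by simp
  then show ?thesis
    by (simp add: M1_def M2_def nn_integral_distr nn_integral_density nn_integral_cmult)
qed

text \<open>Here \<open>\<kappa>\<close> is the fraction of the unit ball inside the cone, the
  number on which both the spherical and the Gaussian estimate rest.\<close>

lemma circ_cone_fraction_ge:
  fixes u :: "real^'d"
  assumes t: "0 < t" "t \<le> 1" and u: "norm u = 1"
  obtains \<kappa> :: real where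
    "emeasure lborel (circ_cone u t \<inter> ball 0 1) = ennreal \<kappa> * emeasure lborel (ball (0::real^'d) 1)"
    "1/3 * (t/2) ^ (CARD('d) - 1) \<le> \<kappa>"
proof
  let ?B = "ball (0::real^'d) 1"
  have Bfin: "emeasure lborel ?B = ennreal (measure lborel ?B)"
    using emeasure_lborel_ball_finite[of "0::real^'d" 1] by (simp add: emeasure_eq_ennreal_measure)
  have Bpos: "measure lborel ?B > 0" by simp
  have "emeasure lborel (circ_cone u t \<inter> ?B) \<le> emeasure lborel ?B" by (intro emeasure_mono) auto
  then have "emeasure lborel (circ_cone u t \<inter> ?B) \<noteq> \<top>" using Bfin by (auto simp: top_unique)
  then have "emeasure lborel (circ_cone u t \<inter> ?B) = ennreal (measure lborel (circ_cone u t \<inter> ?B))"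
    by (rule emeasure_eq_ennreal_measure)
  then show "emeasure lborel (circ_cone u t \<inter> ?B)
      = ennreal (measure lborel (circ_cone u t \<inter> ?B) / measure lborel ?B) * emeasure lborel ?B"
    using Bpos by (simp add: Bfin ennreal_mult'[symmetric])
  show "1/3 * (t/2) ^ (CARD('d) - 1) \<le> measure lborel (circ_cone u t \<inter> ?B) / measure lborel ?B"
    using measure_circ_cone_ge[OF t u] Bpos by (simp add: pos_le_divide_eq)
qed

section \<open>Separation by neurons in a cone\<close>

text \<open>The gain \<open>x / 8\<close> over the trivial bound \<open>1 - c\<close> pays for the radii of the covering balls.\<close>
lemma sqrt_diff_ge:
  fixes c x :: real
  assumes c: "1/2 \<le> c" "c \<le> 1" and x: "0 \<le> x" "x \<le> 1"
  shows "(1 - c) * (1 + x / 8) \<le> sqrt (1 - c\<^sup>2 * x) - c * sqrt (1 - x)"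
proof -
  \<comment> \<open>With this \<open>y\<close> and \<open>e = x / 8\<close> the goal becomes
    \<open>((1 - c) * (1 + e) + c * y)\<^sup>2 \<le> 1 - c\<^sup>2 * x\<close>. There a factor
    \<open>1 - c\<close> splits off and leaves
    \<open>(1 - c) * (e * (2 + e)) \<le> 2 * c * (1 - y - y * e)\<close>.\<close>
  define y where "y = sqrt (1 - x)"
  have y: "0 \<le> y" "y \<le> 1" and xy: "x = 1 - y\<^sup>2" using x by (auto simp: y_def)
  define e where "e = (1 - y) * (1 + y) / 8"
  have "y\<^sup>2 \<le> 1" using y by (simp add: power_le_one)
  then have e8: "e \<le> 1/8" and e0: "0 \<le> e" using y by (auto simp: e_def power2_eq_square algebra_simps)
  have ex: "1 + x / 8 = 1 + e" by (simp add: xy e_def power2_eq_square algebra_simps)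
  have e4: "e \<le> (1 - y) / 4"
    using y mult_left_mono[of "1 + y" 2 "1 - y"] by (simp add: e_def)
  have e2: "e * (2 + e) \<le> (1 - y) / 4 * (17/8)" by (rule mult_mono) (use e4 e8 e0 y in auto)
  have "(1 - c) * (e * (2 + e)) \<le> 1/2 * ((1 - y) / 4 * (17/8))"
    by (rule mult_mono[OF _ e2]) (use c e0 in auto)
  moreover have "2 * c * (1 - y - y * e) \<ge> 1 * ((1 - y) * (3/4))"
  proof (intro mult_mono)
    have "y * (1 + y) \<le> 1 * 2" using y by (intro mult_mono) auto
    then have "(1 - y) * (y * (1 + y)) \<le> (1 - y) * 2" using y by (intro mult_left_mono) auto
    then show "(1 - y) * (3/4) \<le> 1 - y - y * e" by (simp add: e_def field_simps)
  qed (use c y in auto)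
  ultimately have "(1 - c) * (e * (2 + e)) \<le> 2 * c * (1 - y - y * e)"
    using y by argo
  then have "(1 - c) * ((1 - c) * (e * (2 + e))) \<le> (1 - c) * (2 * c * (1 - y - y * e))"
    using c by (intro mult_left_mono) auto
  then have "((1 - c) * (1 + e) + c * y)\<^sup>2 \<le> 1 - c\<^sup>2 * x"
    by (simp add: xy power2_eq_square algebra_simps)
  then have "(1 - c) * (1 + e) + c * y \<le> sqrt (1 - c\<^sup>2 * x)" by (rule real_le_rsqrt)
  then show ?thesis by (simp add: ex y_def)
qed

text \<open>Addition of angles: the sine of the angle from \<open>u\<close> to \<open>w\<close> is
  at most \<open>c * \<sigma>\<close>, and the cosine of the angle from \<open>u\<close> to
  \<open>z\<close> is at least \<sigma>. Splitting both vectors along \<open>u\<close> bounds the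
  cosine of the sum, and \<open>sqrt_diff_ge\<close> simplifies it. The cone is fixed by
  \<open>s\<close>, whereas \<sigma> may vary with \<open>z\<close>.\<close>

lemma circ_cone_inner_ge:
  fixes u w z :: "'a::real_inner"
  assumes w: "w \<in> circ_cone u (c * s)" and u: "norm u = 1"
    and c: "1/2 \<le> c" "c \<le> 1" and s: "0 \<le> s" "s \<le> \<sigma>" "\<sigma> \<le> 1"
    and z: "\<sigma> * norm z \<le> u \<bullet> z"
  shows "norm w * (norm z * \<sigma> * ((1 - c) * (1 + \<sigma>\<^sup>2 / 8))) \<le> w \<bullet> z"
proof -
  define p where "p = u \<bullet> w"
  define a where "a = u \<bullet> z"
  have \<sigma>0: "0 \<le> \<sigma>" using s by simp
  have uu: "u \<bullet> u = 1" using u by (simp add: norm_eq_1)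
  have wz: "w \<bullet> z = p * a + (w - p *\<^sub>R u) \<bullet> (z - a *\<^sub>R u)"
    using uu by (simp add: p_def a_def inner_diff_left inner_diff_right inner_commute algebra_simps)
  have nw: "(norm (w - p *\<^sub>R u))\<^sup>2 = (norm w)\<^sup>2 - p\<^sup>2"
    using uu unfolding power2_norm_eq_inner
    by (simp add: p_def inner_diff_left inner_diff_right inner_commute power2_eq_square)
  have nz: "(norm (z - a *\<^sub>R u))\<^sup>2 = (norm z)\<^sup>2 - a\<^sup>2"
    using uu unfolding power2_norm_eq_inner
    by (simp add: a_def inner_diff_left inner_diff_right inner_commute power2_eq_square)
  have cs: "c * s \<le> c * \<sigma>" "0 \<le> c * s" using c s by (auto intro: mult_left_mono)
  then have cs2: "(c * s)\<^sup>2 \<le> (c * \<sigma>)\<^sup>2" by (intro power_mono)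
  have c\<sigma>: "(c * \<sigma>)\<^sup>2 \<le> 1" using c s \<sigma>0 by (intro power_le_one mult_nonneg_nonneg mult_le_one) auto
  have p1: "sqrt (1 - (c * s)\<^sup>2) * norm w \<le> p" using w by (simp add: circ_cone_def p_def)
  \<comment> \<open>Since \<open>s \<le> \<sigma>\<close>, the cone is enlarged to the one with sine
    \<open>c * \<sigma>\<close>.\<close>
  then have p2: "sqrt (1 - (c * \<sigma>)\<^sup>2) * norm w \<le> p"
    using cs2 by (smt (verit) mult_right_mono norm_ge_zero real_sqrt_le_mono)
  have "(sqrt (1 - (c * \<sigma>)\<^sup>2) * norm w)\<^sup>2 \<le> p\<^sup>2" using p2 c\<sigma> by (intro power_mono) auto
  then have "(norm (w - p *\<^sub>R u))\<^sup>2 \<le> (c * \<sigma> * norm w)\<^sup>2"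
    using c\<sigma> by (simp add: nw power_mult_distrib algebra_simps)
  then have w': "norm (w - p *\<^sub>R u) \<le> c * \<sigma> * norm w"
    by (rule power2_le_imp_le) (use c \<sigma>0 in auto)
  have "(\<sigma> * norm z)\<^sup>2 \<le> a\<^sup>2" using z \<sigma>0 by (intro power_mono) (auto simp: a_def)
  then have "(norm (z - a *\<^sub>R u))\<^sup>2 \<le> (1 - \<sigma>\<^sup>2) * (norm z)\<^sup>2"
    by (simp add: nz power_mult_distrib algebra_simps)
  then have "norm (z - a *\<^sub>R u) \<le> sqrt ((1 - \<sigma>\<^sup>2) * (norm z)\<^sup>2)" by (rule real_le_rsqrt)
  then have z': "norm (z - a *\<^sub>R u) \<le> sqrt (1 - \<sigma>\<^sup>2) * norm z" by (simp add: real_sqrt_mult)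
  have "\<bar>(w - p *\<^sub>R u) \<bullet> (z - a *\<^sub>R u)\<bar> \<le> norm (w - p *\<^sub>R u) * norm (z - a *\<^sub>R u)"
    by (rule Cauchy_Schwarz_ineq2)
  also have "\<dots> \<le> (c * \<sigma> * norm w) * (sqrt (1 - \<sigma>\<^sup>2) * norm z)"
    using w' z' c \<sigma>0 by (intro mult_mono) auto
  finally have cross: "- ((c * \<sigma> * norm w) * (sqrt (1 - \<sigma>\<^sup>2) * norm z)) \<le> (w - p *\<^sub>R u) \<bullet> (z - a *\<^sub>R u)"
    by linarith
  have main: "(sqrt (1 - (c * \<sigma>)\<^sup>2) * norm w) * (\<sigma> * norm z) \<le> p * a"
    using p2 z c\<sigma> \<sigma>0 by (intro mult_mono) (auto simp: a_def intro: order_trans[OF _ p2])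
  have "norm w * (norm z * \<sigma> * (A - c * B)) = (A * norm w) * (\<sigma> * norm z) - (c * \<sigma> * norm w) * (B * norm z)"
    for A B by (simp add: algebra_simps)
  from this[of "sqrt (1 - (c * \<sigma>)\<^sup>2)" "sqrt (1 - \<sigma>\<^sup>2)"] have "norm w * (norm z * \<sigma> * (sqrt (1 - (c * \<sigma>)\<^sup>2) - c * sqrt (1 - \<sigma>\<^sup>2)))
      \<le> p * a + (w - p *\<^sub>R u) \<bullet> (z - a *\<^sub>R u)"
    using cross main by linarith
  then have "norm w * (norm z * \<sigma> * (sqrt (1 - c\<^sup>2 * \<sigma>\<^sup>2) - c * sqrt (1 - \<sigma>\<^sup>2))) \<le> w \<bullet> z"
    by (simp only: wz[symmetric] power_mult_distrib)
  moreover have "norm w * (norm z * \<sigma> * ((1 - c) * (1 + \<sigma>\<^sup>2 / 8)))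
      \<le> norm w * (norm z * \<sigma> * (sqrt (1 - c\<^sup>2 * \<sigma>\<^sup>2) - c * sqrt (1 - \<sigma>\<^sup>2)))"
    using c \<sigma>0 s by (intro mult_left_mono sqrt_diff_ge) (auto simp: power_le_one)
  ultimately show ?thesis by linarith
qed

text \<open>As \<open>y\<close> is no longer than \<open>x\<close>, the vector \<open>x - y\<close>
  makes an angle with \<open>x\<close> whose cosine is at least \<open>dist x y / (2 * R)\<close>.
  The previous bound applies with this cosine as \<sigma>, with \<open>z = x - y\<close> and
  \<open>c = 1 - 1/d\<close>; the factor \<open>1 - c\<close> is where \<open>1/d\<close> comes
  from.\<close>

lemma circ_cone_separates:
  fixes x y w :: "'a::real_inner" and d R \<delta> :: real
  assumes w: "w \<in> circ_cone (sgn x) ((1 - 1/d) * (\<delta> / (2 * R)))"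
    and d: "d \<ge> 2" and xy: "norm y \<le> norm x" "norm x \<le> R" and \<delta>: "0 < \<delta>" "\<delta> \<le> dist x y"
  shows "norm w * ((dist x y)\<^sup>2 / (2 * R * d) * (1 + (dist x y)\<^sup>2 / (32 * R\<^sup>2))) \<le> w \<bullet> x - w \<bullet> y"
proof -
  define D where "D = dist x y"
  have x0: "norm x > 0"
  proof (rule ccontr)
    assume "\<not> norm x > 0"
    then have "x = 0" "y = 0" using xy by auto
    then show False using \<delta> by simp
  qed
  then have R: "R > 0" using xy by linarith
  have D2: "D \<le> 2 * R" using xy norm_triangle_ineq4[of x y] by (simp add: D_def dist_norm)
  have "D\<^sup>2 / 2 \<le> x \<bullet> (x - y)"
  proof -
    have "(norm y)\<^sup>2 \<le> (norm x)\<^sup>2" using xy by (intro power_mono) auto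
    moreover have "D\<^sup>2 = (norm x)\<^sup>2 + (norm y)\<^sup>2 - 2 * (x \<bullet> y)"
      by (simp add: D_def dist_norm power2_norm_eq_inner inner_diff_left inner_diff_right inner_commute)
    ultimately show ?thesis by (simp add: inner_diff_right power2_norm_eq_inner)
  qed
  then have "D\<^sup>2 / 2 / norm x \<le> sgn x \<bullet> (x - y)"
    using x0 by (simp add: sgn_div_norm field_simps)
  moreover have "D\<^sup>2 / 2 / R \<le> D\<^sup>2 / 2 / norm x"
    using x0 xy R by (intro divide_left_mono) auto
  ultimately have z: "D / (2 * R) * norm (x - y) \<le> sgn x \<bullet> (x - y)"
    by (simp add: D_def dist_norm power2_eq_square)
  have "norm w * (norm (x - y) * (D / (2*R)) * ((1 - (1 - 1/d)) * (1 + (D / (2*R))\<^sup>2 / 8))) \<le> w \<bullet> (x - y)"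
    using d D2 R \<delta> x0
    by (intro circ_cone_inner_ge[OF w _ _ _ _ _ _ z]) (auto simp: norm_sgn field_simps D_def)
  also have "norm (x - y) * (D / (2*R)) * ((1 - (1 - 1/d)) * (1 + (D / (2*R))\<^sup>2 / 8))
      = D\<^sup>2 / (2 * R * d) * (1 + D\<^sup>2 / (32 * R\<^sup>2))"
    using d R by (simp add: D_def dist_norm field_simps power2_eq_square)
  finally show ?thesis by (simp add: D_def inner_diff_right)
qed

section \<open>Output weights and the margin\<close>

lemma geometric_weights:
  fixes q :: real
  assumes "j < N"
  shows "(q - 1) * (\<Sum>k\<in>{j<..<N}. q ^ (N - 1 - k)) = q ^ (N - 1 - j) - 1"
proof -
  have "(\<Sum>k\<in>{j<..<N}. q ^ (N - 1 - k)) = (\<Sum>m<N - 1 - j. q ^ m)"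
    by (rule sum.reindex_bij_witness[of _ "\<lambda>m. N - 1 - m" "\<lambda>k. N - 1 - k"]) auto
  then show ?thesis using power_diff_1_eq[of q "N - 1 - j"] by simp
qed

text \<open>\<open>C k\<close> stands for the data near centre \<open>k\<close>,
  \<open>\<nu> k\<close> for the neuron chosen for it and \<open>\<rho> k\<close> for the norm of
  its weights. The features are triangular: a neuron is silent on later data of the other class, so
  only later neurons can do harm, and geometrically decreasing weights outvote them.\<close>

lemma lin_sep_margin_of_triangular_features:
  fixes \<Phi> :: "'x \<Rightarrow> real^'n" and \<nu> :: "nat \<Rightarrow> 'n" and \<rho> :: "nat \<Rightarrow> real" and C :: "nat \<Rightarrow> 'x set"
  assumes R: "R > 0" and \<gamma>: "\<gamma> > 0" and ne: "Xp \<union> Xm \<noteq> {}"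
    and Xp: "Xp \<subseteq> (\<Union>k\<in>{k. k < N \<and> pos k}. C k)" and Xm: "Xm \<subseteq> (\<Union>k\<in>{k. k < N \<and> \<not> pos k}. C k)"
    and \<rho>: "\<And>k. k < N \<Longrightarrow> \<rho> k \<ge> 1"
    and nonneg: "\<And>k x. k < N \<Longrightarrow> \<Phi> x $ \<nu> k \<ge> 0"
    and upper: "\<And>j k x. j < N \<Longrightarrow> k < N \<Longrightarrow> x \<in> C j \<Longrightarrow> \<Phi> x $ \<nu> k \<le> 2 * R * \<rho> k"
    and lower: "\<And>k x. k < N \<Longrightarrow> x \<in> C k \<Longrightarrow> \<Phi> x $ \<nu> k \<ge> \<gamma> * \<rho> k"
    and zero: "\<And>j k x. k < j \<Longrightarrow> j < N \<Longrightarrow> pos j \<noteq> pos k \<Longrightarrow> x \<in> C j \<Longrightarrow> \<Phi> x $ \<nu> k = 0"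
  shows "lin_sep_margin (margin_M R \<gamma> N) (\<Phi> ` Xp) (\<Phi> ` Xm)"
proof -
  define q where "q = 1 + 2 * R / \<gamma>"
  have q1: "q > 1" using R \<gamma> by (simp add: q_def)
  have q\<gamma>: "2 * R = \<gamma> * (q - 1)" using \<gamma> by (simp add: q_def)
  define \<alpha> where "\<alpha> k = q ^ (N - 1 - k)" for k
  have \<alpha>0: "\<alpha> k > 0" for k using q1 by (simp add: \<alpha>_def)
  define sg :: "nat \<Rightarrow> real" where "sg k = (if pos k then 1 else -1)" for k
  define a :: "real^'n" where "a = (\<Sum>k<N. (sg k * \<alpha> k / \<rho> k) *\<^sub>R axis (\<nu> k) 1)"
  have N0: "N > 0" using ne Xp Xm by auto
  have score: "\<gamma> \<le> sg j * (a \<bullet> \<Phi> x)" if j: "j < N" and x: "x \<in> C j" for j x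
  proof -
    define \<psi> where "\<psi> k = \<Phi> x $ \<nu> k / \<rho> k" for k
    have \<psi>: "0 \<le> \<psi> k" "\<psi> k \<le> 2 * R" if "k < N" for k
      using nonneg[OF that, of x] upper[OF j that x] \<rho>[OF that] by (auto simp: \<psi>_def field_simps)
    have \<psi>j: "\<gamma> \<le> \<psi> j" using lower[OF j x] \<rho>[OF j] by (simp add: \<psi>_def field_simps)
    \<comment> \<open>Worst case of each summand on \<open>C j\<close>. An earlier neuron agrees in
      sign or vanishes, the own neuron gives at least \<open>\<gamma> * \<alpha> j\<close>, and a
      later one may vote wrongly with full strength.\<close>
    have termwise: "(if k = j then \<gamma> * \<alpha> k else if j < k then - (2 * R * \<alpha> k) else 0) \<le> sg j * sg k * (\<alpha> k * \<psi> k)"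
      if k: "k < N" for k
    proof (cases k j rule: linorder_cases)
      case less
      then show ?thesis
        using zero[OF less j _ x] mult_nonneg_nonneg[OF less_imp_le[OF \<alpha>0[of k]] \<psi>(1)[OF k]]
        by (cases "pos j = pos k") (auto simp: sg_def \<psi>_def)
    next
      case equal
      then show ?thesis using \<psi>j \<alpha>0[of k] by (auto simp: sg_def mult.commute)
    next
      case greater
      have "\<alpha> k * \<psi> k \<le> 2 * R * \<alpha> k" "0 \<le> \<alpha> k * \<psi> k" using \<psi>[OF k] \<alpha>0[of k] by (auto simp: mult.commute)
      then show ?thesis using greater by (auto simp: sg_def)
    qed
    have "(\<Sum>k<N. if k = j then \<gamma> * \<alpha> k else if j < k then - (2 * R * \<alpha> k) else 0)
        = (\<Sum>k\<in>insert j {j<..<N}. if k = j then \<gamma> * \<alpha> k else if j < k then - (2 * R * \<alpha> k) else 0)"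
      using j by (intro sum.mono_neutral_right) auto
    also have "\<dots> = \<gamma> * \<alpha> j - 2 * R * (\<Sum>k\<in>{j<..<N}. \<alpha> k)"
      by (simp add: sum_negf sum_distrib_left)
    \<comment> \<open>The base \<open>q\<close> is chosen to make this work: as
      \<open>2 * R = \<gamma> * (q - 1)\<close>, all later weights together cost
      \<open>\<gamma> * (\<alpha> j - 1)\<close>, and exactly \<gamma> remains.\<close>
    also have "\<dots> = \<gamma> * \<alpha> j - \<gamma> * ((q - 1) * (\<Sum>k\<in>{j<..<N}. \<alpha> k))" by (simp add: q\<gamma>)
    also have "\<dots> = \<gamma>"
      unfolding \<alpha>_def geometric_weights[OF j, of q] by (simp add: algebra_simps)
    finally have "\<gamma> = (\<Sum>k<N. if k = j then \<gamma> * \<alpha> k else if j < k then - (2 * R * \<alpha> k) else 0)" ..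
    also have "\<dots> \<le> (\<Sum>k<N. sg j * sg k * (\<alpha> k * \<psi> k))" using termwise by (intro sum_mono) auto
    also have "\<dots> = sg j * (a \<bullet> \<Phi> x)"
      by (simp add: a_def inner_sum_left inner_axis' \<psi>_def sum_distrib_left mult_ac)
    finally show ?thesis .
  qed
  have scorep: "\<gamma> \<le> a \<bullet> \<Phi> x" if x: "x \<in> Xp" for x
  proof -
    obtain j where "j < N" "pos j" "x \<in> C j" using Xp x by blast
    then show ?thesis using score[of j x] by (simp add: sg_def)
  qed
  have scorem: "a \<bullet> \<Phi> x \<le> - \<gamma>" if x: "x \<in> Xm" for x
  proof -
    obtain j where "j < N" "\<not> pos j" "x \<in> C j" using Xm x by blast
    then show ?thesis using score[of j x] by (simp add: sg_def)
  qed
  have a0: "a \<noteq> 0"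
  proof
    assume "a = 0"
    then have "Xp = {}" "Xm = {}" using scorep scorem \<gamma> by fastforce+
    then show False using ne by simp
  qed
  define S where "S = (\<Sum>k<N. (\<alpha> k)\<^sup>2)"
  have S: "(q\<^sup>2 - 1) * S = q ^ (2 * N) - 1"
  proof -
    have "S = (\<Sum>m<N. (q\<^sup>2) ^ m)" unfolding S_def \<alpha>_def
      by (rule sum.reindex_bij_witness[of _ "\<lambda>m. N - 1 - m" "\<lambda>k. N - 1 - k"])
         (auto simp: power_mult[symmetric] mult.commute)
    then show ?thesis using power_diff_1_eq[of "q\<^sup>2" N] by (simp add: power_mult)
  qed
  have S0: "S > 0" using N0 \<alpha>0 unfolding S_def by (intro sum_pos) (auto simp: less_imp_neq[THEN not_sym])
  \<comment> \<open>The triangle inequality rather than orthogonality, since \<open>\<nu>\<close>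
    may repeat neurons. Cauchy-Schwarz then introduces the factor \<open>N\<close>.\<close>
  have "norm a \<le> (\<Sum>k<N. norm ((sg k * \<alpha> k / \<rho> k) *\<^sub>R (axis (\<nu> k) 1 :: real^'n)))"
    unfolding a_def by (rule norm_sum)
  also have "\<dots> \<le> (\<Sum>k<N. \<alpha> k)"
  proof (rule sum_mono)
    fix k assume "k \<in> {..<N}"
    then have "\<rho> k \<ge> 1" using \<rho> by simp
    then have "\<alpha> k / \<rho> k \<le> \<alpha> k / 1" using \<alpha>0[of k] by (intro divide_left_mono) auto
    then show "norm ((sg k * \<alpha> k / \<rho> k) *\<^sub>R (axis (\<nu> k) 1 :: real^'n)) \<le> \<alpha> k"
      using \<alpha>0[of k] \<open>\<rho> k \<ge> 1\<close> by (auto simp: sg_def abs_mult)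
  qed
  finally have "(norm a)\<^sup>2 \<le> (\<Sum>k<N. \<alpha> k)\<^sup>2" by (intro power_mono) auto
  also have "\<dots> \<le> real N * S"
    using sum_squared_le_sum_of_squares[of \<alpha> "{..<N}"] by (simp add: S_def mult.commute)
  finally have na: "norm a \<le> sqrt (real N * S)" by (rule real_le_rsqrt)
  \<comment> \<open>Together with the closed form of \<open>S\<close> this identifies
    \<open>margin_M R \<gamma> N\<close> as \<open>\<gamma> / sqrt (N * S)\<close>: guaranteed score
    over norm bound.\<close>
  have q2: "4 * R * (R + \<gamma>) = \<gamma>\<^sup>2 * (q\<^sup>2 - 1)"
    using \<gamma> by (simp add: q_def power2_eq_square field_simps)
  have "q\<^sup>2 - 1 > 0" using q1 by (simp add: one_less_power)
  then have "4 * R * (R + \<gamma>) / (real N * q ^ (2 * N) - real N) = \<gamma>\<^sup>2 / (real N * S)"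
  proof -
    have "real N * q ^ (2 * N) - real N = real N * ((q\<^sup>2 - 1) * S)"
      unfolding S by (simp add: algebra_simps)
    moreover have "\<gamma>\<^sup>2 * v / (real N * (v * S)) = \<gamma>\<^sup>2 / (real N * S)" if "v > 0" for v
      using that by simp
    ultimately show ?thesis using \<open>q\<^sup>2 - 1 > 0\<close> by (simp only: q2)
  qed
  then have M: "margin_M R \<gamma> N = \<gamma> / sqrt (real N * S)"
    using \<gamma> by (simp add: margin_M_def q_def real_sqrt_divide)
  have margin: "margin_M R \<gamma> N \<le> v / norm a" if "\<gamma> \<le> v" for v
    unfolding M using that \<gamma> na a0 by (intro frac_le) auto
  show ?thesis unfolding lin_sep_margin_def
  proof (intro exI[of _ a] exI[of _ 0] conjI ballI a0)
    fix s assume "s \<in> \<Phi> ` Xp" then show "a \<bullet> s + 0 > 0" using scorep \<gamma> by force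
  next
    fix s assume "s \<in> \<Phi> ` Xm" then show "a \<bullet> s + 0 < 0" using scorem \<gamma> by force
  next
    fix s assume "s \<in> \<Phi> ` Xp \<union> \<Phi> ` Xm"
    then have "\<gamma> \<le> \<bar>a \<bullet> s + 0\<bar>" using scorep scorem \<gamma> by force
    then show "margin_M R \<gamma> N \<le> \<bar>a \<bullet> s + 0\<bar> / norm a" by (rule margin)
  qed
qed

section \<open>Random matrices with independent rows\<close>

text \<open>Independence in the form in which it gets used: integrals of products of one function
  over all rows. The event that every neuron misses a given set leads to just such products.\<close>

definition iid_rows :: "(real^'d^'n) measure \<Rightarrow> (real^'d) measure \<Rightarrow> bool" where
  "iid_rows M G \<longleftrightarrow> sets M = sets borel \<and> sets G = sets borel \<and> prob_space G \<and>
     (\<forall>f \<in> borel_measurable borel. (\<integral>\<^sup>+W. (\<Prod>i\<in>UNIV. f (W $ i)) \<partial>M) = (\<integral>\<^sup>+w. f w \<partial>G) ^ CARD('n))"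

lemma iid_rows_nn_integral:
  fixes M :: "(real^'d^'n) measure"
  assumes "iid_rows M G" and "f \<in> borel_measurable borel"
  shows "(\<integral>\<^sup>+W. (\<Prod>i\<in>UNIV. f (W $ i)) \<partial>M) = (\<integral>\<^sup>+w. f w \<partial>G) ^ CARD('n)"
  using assms by (simp add: iid_rows_def)

lemma iid_rows_prob_space:
  assumes "iid_rows (M :: (real^'d^'n) measure) G"
  shows "prob_space M"
proof
  interpret G: prob_space G using assms by (simp add: iid_rows_def)
  have "(\<integral>\<^sup>+W. (\<Prod>i\<in>(UNIV::'n set). 1) \<partial>M) = (\<integral>\<^sup>+w. 1 \<partial>G) ^ CARD('n)"
    by (rule iid_rows_nn_integral[OF assms]) simp
  then show "emeasure M (space M) = 1" by (simp add: G.emeasure_space_1)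
qed

lemma prob_space_unif_sphere: "prob_space (unif_sphere :: (real^'d) measure)"
proof -
  interpret prob_space "uniform_measure lborel (ball (0::real^'d) 1)"
    using emeasure_lborel_ball_finite[of "0::real^'d" 1] unit_ball_vol_pos[of "real CARD('d)"]
    by (intro prob_space_uniform_measure) (auto simp: emeasure_ball ennreal_eq_0_iff not_le)
  show ?thesis unfolding unif_sphere_def by (rule prob_space_distr) simp
qed

lemma iid_rows_sphere: "iid_rows (sphere_rows :: (real^'d^'n) measure) unif_sphere"
  unfolding iid_rows_def
proof (intro conjI ballI prob_space_unif_sphere)
  interpret G: prob_space "unif_sphere :: (real^'d) measure" by (rule prob_space_unif_sphere)
  interpret product_sigma_finite "\<lambda>_::'n. (unif_sphere :: (real^'d) measure)"
    by standard
  show sG[simp, measurable_cong]: "sets (unif_sphere :: (real^'d) measure) = sets borel" by (simp add: unif_sphere_def)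
  show "sets (sphere_rows :: (real^'d^'n) measure) = sets borel" by (simp add: sphere_rows_def)
  have [measurable]: "(\<lambda>f. \<chi> i. f i) \<in> (\<Pi>\<^sub>M i\<in>(UNIV::'n set). (unif_sphere :: (real^'d) measure)) \<rightarrow>\<^sub>M borel"
    using measurable_vec_lambda by (simp cong: measurable_cong_sets sets_PiM_cong)
  fix f :: "real^'d \<Rightarrow> ennreal" assume f[measurable]: "f \<in> borel_measurable borel"
  have [measurable]: "(\<lambda>x::real^'d^'n. f (x $ i)) \<in> borel_measurable borel" for i
    by (rule measurable_compose[OF _ f]) (intro borel_measurable_continuous_onI continuous_intros)
  show "(\<integral>\<^sup>+W. (\<Prod>i\<in>UNIV. f (W $ i)) \<partial>(sphere_rows :: (real^'d^'n) measure)) = (\<integral>\<^sup>+w. f w \<partial>unif_sphere) ^ CARD('n)"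
    unfolding sphere_rows_def
    by (simp add: nn_integral_distr product_nn_integral_prod[where f="\<lambda>_. f"])
qed

definition gauss_row :: "(real^'d) measure" where
  "gauss_row = density lborel (\<lambda>w. ennreal (\<Prod>j\<in>UNIV. std_normal_density (w $ j)))"

lemma nn_integral_gauss_row_prod:
  fixes f :: "'d::finite \<Rightarrow> real \<Rightarrow> ennreal"
  assumes [measurable]: "\<And>j. f j \<in> borel_measurable borel"
  shows "(\<integral>\<^sup>+w. (\<Prod>j\<in>UNIV. f j (w $ j)) \<partial>gauss_row) = (\<Prod>j\<in>UNIV. \<integral>\<^sup>+y. ennreal (std_normal_density y) * f j y \<partial>lborel)"
proof -
  have [measurable]: "(\<lambda>x::real^'d. f i (x $ i)) \<in> borel_measurable borel" for i
    by (rule measurable_compose[OF _ assms]) (intro borel_measurable_continuous_onI continuous_intros)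
  show ?thesis
    by (subst nn_integral_lborel_vec_prod[symmetric])
       (auto simp: gauss_row_def nn_integral_density prod_ennreal[symmetric] prod.distrib)
qed

lemma nn_integral_std_normal: "(\<integral>\<^sup>+y. ennreal (std_normal_density y) \<partial>lborel) = 1"
proof -
  interpret prob_space "density lborel std_normal_density"
    by (rule prob_space_normal_density) simp
  show ?thesis using emeasure_space_1 by (simp add: emeasure_density)
qed

lemma prob_space_gauss_row: "prob_space (gauss_row :: (real^'d) measure)"
proof
  have "(\<integral>\<^sup>+w. (\<Prod>j\<in>(UNIV::'d set). 1) \<partial>(gauss_row :: (real^'d) measure)) = 1"
    by (subst nn_integral_gauss_row_prod) (simp_all add: nn_integral_std_normal)
  then show "emeasure (gauss_row :: (real^'d) measure) (space gauss_row) = 1" by simp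
qed

text \<open>The matrix density is a product of row densities, so Tonelli over vector-valued
  components factors the integral.\<close>

lemma iid_rows_gauss: "iid_rows (gauss_matrix :: (real^'d^'n) measure) gauss_row"
  unfolding iid_rows_def
proof (intro conjI ballI prob_space_gauss_row)
  show "sets (gauss_row :: (real^'d) measure) = sets borel" by (simp add: gauss_row_def)
  show "sets (gauss_matrix :: (real^'d^'n) measure) = sets borel" by (simp add: gauss_matrix_def)
  fix f :: "real^'d \<Rightarrow> ennreal" assume f[measurable]: "f \<in> borel_measurable borel"
  have [measurable]: "(\<lambda>x::real^'d^'n. f (x $ i)) \<in> borel_measurable borel" for i
    by (rule measurable_compose[OF _ f]) (intro borel_measurable_continuous_onI continuous_intros)
  have [measurable]: "(\<lambda>x::real^'d^'n. std_normal_density (x $ i $ j)) \<in> borel_measurable borel" for i j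
    by (rule measurable_compose[OF _ borel_measurable_normal_density])
       (intro borel_measurable_continuous_onI continuous_intros)
  show "(\<integral>\<^sup>+W. (\<Prod>i\<in>UNIV. f (W $ i)) \<partial>(gauss_matrix :: (real^'d^'n) measure)) = (\<integral>\<^sup>+w. f w \<partial>gauss_row) ^ CARD('n)"
    unfolding gauss_matrix_def gauss_row_def
    using nn_integral_lborel_vec_prod[of "\<lambda>(_::'n) w. ennreal (\<Prod>j\<in>UNIV. std_normal_density (w $ j)) * f w"]
    by (simp add: nn_integral_density prod_ennreal[symmetric] prod.distrib prod_nonneg)
qed

lemma prob_space_uniform_interval:
  assumes "L > 0" shows "prob_space (uniform_measure lborel {-L..L::real})"
  using assms by (intro prob_space_uniform_measure) auto

text \<open>The indicator of the cube is the product of the interval indicators, and its volume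
  \<open>(2 * L) ^ CARD('n)\<close> supplies one normalising factor per coordinate.\<close>

lemma nn_integral_unif_bias_prod:
  fixes f :: "'n::finite \<Rightarrow> real \<Rightarrow> ennreal"
  assumes L: "L > 0" and [measurable]: "\<And>i. f i \<in> borel_measurable borel"
  shows "(\<integral>\<^sup>+b. (\<Prod>i\<in>UNIV. f i (b $ i)) \<partial>unif_bias L) = (\<Prod>i\<in>UNIV. \<integral>\<^sup>+y. f i y \<partial>uniform_measure lborel {-L..L})"
proof -
  let ?C = "cbox (- (L *\<^sub>R One)) (L *\<^sub>R One) :: (real^'n) set"
  have [measurable]: "(\<lambda>x::real^'n. f i (x $ i)) \<in> borel_measurable borel" for i
    by (rule measurable_compose[OF _ assms(2)]) (intro borel_measurable_continuous_onI continuous_intros)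
  have C: "b \<in> ?C \<longleftrightarrow> (\<forall>i. b $ i \<in> {-L..L})" for b
  proof -
    have "(One :: real^'n) $ i = 1" for i
      using inner_sum_left_Basis[of "axis i 1 :: real^'n" "\<lambda>_. 1"]
      by (simp add: cart_eq_inner_axis)
    then show ?thesis by (auto simp: mem_box_cart)
  qed
  have ind: "indicator ?C b = (\<Prod>i\<in>UNIV. indicator {-L..L} (b $ i) :: ennreal)" for b
    using C[of b] by (auto simp: indicator_def prod_zero_iff)
  have vol: "emeasure lborel ?C = ennreal ((2 * L) ^ CARD('n))"
  proof -
    have "emeasure lborel ?C = (\<integral>\<^sup>+b. indicator ?C b \<partial>lborel)" by simp
    also have "\<dots> = (\<integral>\<^sup>+b. (\<Prod>i\<in>UNIV. indicator {-L..L} (b $ i)) \<partial>(lborel :: (real^'n) measure))"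
      by (intro nn_integral_cong ind)
    also have "\<dots> = (\<Prod>i\<in>(UNIV::'n set). ennreal (2 * L))"
      using L by (subst nn_integral_lborel_vec_prod) auto
    finally show ?thesis using L by (simp add: ennreal_power)
  qed
  have div: "x / ennreal c = x * ennreal (1 / c)" if "c > 0" for x c
    using that by (simp add: divide_ennreal_def inverse_ennreal inverse_eq_divide)
  have "(\<integral>\<^sup>+b. (\<Prod>i\<in>UNIV. f i (b $ i)) \<partial>unif_bias L) = (\<integral>\<^sup>+b. (\<Prod>i\<in>UNIV. f i (b $ i) * indicator {-L..L} (b $ i)) \<partial>lborel) * ennreal (1 / (2 * L) ^ CARD('n))"
    unfolding unif_bias_def using L
    by (subst nn_integral_uniform_measure) (auto simp: vol div ind prod.distrib)
  also have "\<dots> = (\<Prod>i\<in>UNIV. \<integral>\<^sup>+y. f i y * indicator {-L..L} y \<partial>lborel) * (\<Prod>i\<in>(UNIV::'n set). ennreal (1 / (2 * L)))"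
    using L by (subst nn_integral_lborel_vec_prod) (auto simp: ennreal_power power_one_over)
  also have "\<dots> = (\<Prod>i\<in>UNIV. \<integral>\<^sup>+y. f i y \<partial>uniform_measure lborel {-L..L})"
    using L by (simp add: nn_integral_uniform_measure prod.distrib div)
  finally show ?thesis .
qed

lemma prob_space_unif_bias:
  assumes "L > 0" shows "prob_space (unif_bias L :: (real^'n) measure)"
proof
  interpret prob_space "uniform_measure lborel {-L..L}" using assms by (rule prob_space_uniform_interval)
  have "(\<integral>\<^sup>+b. (\<Prod>i\<in>(UNIV::'n set). 1) \<partial>(unif_bias L :: (real^'n) measure)) = 1"
    using assms emeasure_space_1 by (subst nn_integral_unif_bias_prod) auto
  then show "emeasure (unif_bias L :: (real^'n) measure) (space (unif_bias L)) = 1" by simp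
qed

section \<open>Independent neurons and the union bound\<close>

lemma measurable_row_pair [measurable]:
  "(\<lambda>z::(real^'d^'n) \<times> (real^'n). (fst z $ i, snd z $ i)) \<in> borel \<Otimes>\<^sub>M borel \<rightarrow>\<^sub>M borel \<Otimes>\<^sub>M borel"
proof -
  have 1: "(\<lambda>W::real^'d^'n. W $ i) \<in> borel \<rightarrow>\<^sub>M borel"
    by (intro borel_measurable_continuous_onI continuous_intros)
  have 2: "(\<lambda>b::real^'n. b $ i) \<in> borel \<rightarrow>\<^sub>M borel"
    by (intro borel_measurable_continuous_onI continuous_intros)
  show ?thesis
    by (intro measurable_Pair measurable_compose[OF measurable_fst 1] measurable_compose[OF measurable_snd 2])
qed

lemma sets_all_neurons:
  assumes "A \<in> sets (borel \<Otimes>\<^sub>M borel)"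
  shows "{z :: (real^'d^'n) \<times> (real^'n). \<forall>i. (fst z $ i, snd z $ i) \<in> A} \<in> sets (borel \<Otimes>\<^sub>M borel)"
proof -
  have "{z :: (real^'d^'n) \<times> (real^'n). \<forall>i. (fst z $ i, snd z $ i) \<in> A}
      = (\<Inter>i. (\<lambda>z. (fst z $ i, snd z $ i)) -` A \<inter> space (borel \<Otimes>\<^sub>M borel))"
    by (auto simp: space_pair_measure)
  also have "\<dots> \<in> sets (borel \<Otimes>\<^sub>M borel)"
    by (intro sets.finite_INT measurable_sets[OF measurable_row_pair assms]) auto
  finally show ?thesis .
qed

text \<open>The pairs of row and bias behave like independent draws. For fixed \<open>W\<close> the
  section of the event factors over the biases; the remaining integral over \<open>W\<close> factors
  over the rows.\<close>

lemma emeasure_all_neurons: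
  fixes A :: "((real^'d) \<times> real) set" and M :: "(real^'d^'n) measure"
  assumes iid: "iid_rows M G" and L: "L > 0" and A: "A \<in> sets (borel \<Otimes>\<^sub>M borel)"
  shows "emeasure (M \<Otimes>\<^sub>M unif_bias L) {z. \<forall>i. (fst z $ i, snd z $ i) \<in> A}
       = emeasure (G \<Otimes>\<^sub>M uniform_measure lborel {-L..L}) A ^ CARD('n)"
proof -
  let ?U = "uniform_measure lborel {-L..L}"
  have [measurable_cong, simp]: "sets M = sets borel" "sets G = sets borel"
    using iid by (auto simp: iid_rows_def)
  have [measurable_cong, simp]: "sets (unif_bias L :: (real^'n) measure) = sets borel"
    by (simp add: unif_bias_def)
  have [measurable]: "A \<in> sets (G \<Otimes>\<^sub>M ?U)"
    using A by (simp cong: sets_pair_measure_cong)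
  interpret B: prob_space "unif_bias L :: (real^'n) measure" using L by (rule prob_space_unif_bias)
  interpret U: prob_space ?U using L by (rule prob_space_uniform_interval)
  define X where "X = {z :: (real^'d^'n) \<times> (real^'n). \<forall>i. (fst z $ i, snd z $ i) \<in> A}"
  have X: "X \<in> sets (borel \<Otimes>\<^sub>M borel)" unfolding X_def using A by (rule sets_all_neurons)
  have X'[measurable]: "X \<in> sets (M \<Otimes>\<^sub>M unif_bias L)" using X by (simp cong: sets_pair_measure_cong)
  have [measurable]: "Pair w -` A \<in> sets borel" for w using A by (rule sets_Pair1)
  have [measurable]: "Pair W -` X \<in> sets borel" for W using X by (rule sets_Pair1)
  have "emeasure (M \<Otimes>\<^sub>M unif_bias L) X = (\<integral>\<^sup>+W. emeasure (unif_bias L) (Pair W -` X) \<partial>M)"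
    by (rule B.emeasure_pair_measure_alt[OF X'])
  also have "\<dots> = (\<integral>\<^sup>+W. (\<Prod>i\<in>UNIV. emeasure ?U (Pair (W $ i) -` A)) \<partial>M)"
  proof (rule nn_integral_cong)
    fix W :: "real^'d^'n"
    have "emeasure (unif_bias L) (Pair W -` X) = (\<integral>\<^sup>+b. indicator (Pair W -` X) b \<partial>unif_bias L)" by simp
    also have "\<dots> = (\<integral>\<^sup>+b. (\<Prod>i\<in>UNIV. indicator (Pair (W $ i) -` A) (b $ i)) \<partial>unif_bias L)"
      by (intro nn_integral_cong) (auto simp: X_def indicator_def prod_zero_iff)
    also have "\<dots> = (\<Prod>i\<in>UNIV. emeasure ?U (Pair (W $ i) -` A))"
      by (subst nn_integral_unif_bias_prod[OF L]) auto
    finally show "emeasure (unif_bias L) (Pair W -` X) = (\<Prod>i\<in>UNIV. emeasure ?U (Pair (W $ i) -` A))" .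
  qed
  also have "\<dots> = (\<integral>\<^sup>+w. emeasure ?U (Pair w -` A) \<partial>G) ^ CARD('n)"
  proof -
    have "(\<lambda>w. emeasure ?U (Pair w -` A)) \<in> borel_measurable G" by measurable
    then have "(\<lambda>w. emeasure ?U (Pair w -` A)) \<in> borel_measurable borel"
      by (simp cong: measurable_cong_sets)
    then show ?thesis by (rule iid_rows_nn_integral[OF iid])
  qed
  also have "\<dots> = emeasure (G \<Otimes>\<^sub>M ?U) A ^ CARD('n)"
    by (subst U.emeasure_pair_measure_alt) (use A in \<open>simp_all cong: sets_pair_measure_cong\<close>)
  finally show ?thesis by (simp add: X_def)
qed

text \<open>Union bound. All neurons miss \<open>A k\<close> with probability at most
  \<open>(1 - q) ^ CARD('n) \<le> exp (- q * CARD('n))\<close>, which the width makes at most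
  \<open>\<eta> / N\<close>. The set \<open>S\<close> may be non-measurable; the measurable witness
  is the complement of the bad events.\<close>

lemma with_prob_all_events_hit:
  fixes A :: "nat \<Rightarrow> ((real^'d) \<times> real) set" and M :: "(real^'d^'n) measure"
  assumes iid: "iid_rows M G" and L: "L > 0" and A: "\<And>k. k < N \<Longrightarrow> A k \<in> sets (borel \<Otimes>\<^sub>M borel)"
    and q: "q > 0" "\<And>k. k < N \<Longrightarrow> q \<le> measure (G \<Otimes>\<^sub>M uniform_measure lborel {-L..L}) (A k)"
    and N: "N > 0" and \<eta>: "\<eta> > 0" and n: "real CARD('n) \<ge> ln (real N / \<eta>) / q"
    and S: "\<And>W b. (\<And>k. k < N \<Longrightarrow> \<exists>i. (W $ i, b $ i) \<in> A k) \<Longrightarrow> (W, b) \<in> S"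
  shows "with_prob_at_least (M \<Otimes>\<^sub>M unif_bias L) (1 - \<eta>) S"
proof -
  let ?U = "uniform_measure lborel {-L..L}"
  let ?P = "M \<Otimes>\<^sub>M (unif_bias L :: (real^'n) measure)"
  have sM: "sets M = sets borel" "sets G = sets borel" and G: "prob_space G"
    using iid by (auto simp: iid_rows_def)
  have sB: "sets (unif_bias L :: (real^'n) measure) = sets borel" by (simp add: unif_bias_def)
  have spP: "sets ?P = sets (borel \<Otimes>\<^sub>M borel)" using sM sB by (intro sets_pair_measure_cong) auto
  have spQ: "sets (G \<Otimes>\<^sub>M ?U) = sets (borel \<Otimes>\<^sub>M borel)" using sM by (intro sets_pair_measure_cong) auto
  interpret M: prob_space M using iid by (rule iid_rows_prob_space)
  interpret B: prob_space "unif_bias L :: (real^'n) measure" using L by (rule prob_space_unif_bias)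
  interpret G: prob_space G by (rule G)
  interpret U: prob_space ?U using L by (rule prob_space_uniform_interval)
  interpret P: pair_prob_space M "unif_bias L :: (real^'n) measure" ..
  interpret Q: pair_prob_space G ?U ..
  have spaceP: "space ?P = UNIV" using sets_eq_imp_space_eq[OF spP] by (simp add: space_pair_measure)
  have spaceQ: "space (G \<Otimes>\<^sub>M ?U) = UNIV" using sets_eq_imp_space_eq[OF spQ] by (simp add: space_pair_measure)
  define bad where "bad k = {z :: (real^'d^'n) \<times> (real^'n). \<forall>i. (fst z $ i, snd z $ i) \<in> - A k}" for k
  have cA: "- A k \<in> sets (borel \<Otimes>\<^sub>M borel)" if "k < N" for k
    using sets.compl_sets[OF A[OF that]] by (simp add: Compl_eq_Diff_UNIV space_pair_measure)
  have bad_sets: "bad k \<in> sets ?P" if "k < N" for k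
    unfolding spP bad_def using cA[OF that] by (rule sets_all_neurons)
  have bad: "measure ?P (bad k) \<le> \<eta> / real N" if k: "k < N" for k
  proof -
    have "emeasure ?P (bad k) = emeasure (G \<Otimes>\<^sub>M ?U) (- A k) ^ CARD('n)"
      unfolding bad_def by (rule emeasure_all_neurons[OF iid L cA[OF k]])
    then have "measure ?P (bad k) = measure (G \<Otimes>\<^sub>M ?U) (- A k) ^ CARD('n)"
      by (simp add: P.emeasure_eq_measure Q.emeasure_eq_measure ennreal_power)
    also have "measure (G \<Otimes>\<^sub>M ?U) (- A k) = 1 - measure (G \<Otimes>\<^sub>M ?U) (A k)"
      using Q.prob_compl[of "A k"] A[OF k] spQ spaceQ by (simp add: Compl_eq_Diff_UNIV)
    also have "(1 - measure (G \<Otimes>\<^sub>M ?U) (A k)) ^ CARD('n) \<le> exp (- q) ^ CARD('n)"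
    proof (rule power_mono)
      show "1 - measure (G \<Otimes>\<^sub>M ?U) (A k) \<le> exp (- q)"
        using q(2)[OF k] exp_ge_add_one_self[of "- q"] by linarith
    qed simp
    also have "\<dots> = exp (- (real CARD('n) * q))" by (simp add: exp_of_nat_mult[symmetric])
    also have "\<dots> \<le> exp (- ln (real N / \<eta>))"
      using n q(1) by (simp add: field_simps)
    also have "\<dots> = \<eta> / real N" using N \<eta> by (simp add: exp_minus)
    finally show ?thesis .
  qed
  define E where "E = space ?P - (\<Union>k<N. bad k)"
  have "measure ?P (\<Union>k<N. bad k) \<le> (\<Sum>k<N. measure ?P (bad k))"
    using bad_sets by (intro P.finite_measure_subadditive_finite) auto
  also have "\<dots> \<le> (\<Sum>k<N. \<eta> / real N)" using bad by (intro sum_mono) auto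
  also have "\<dots> = \<eta>" using N by simp
  finally have "1 - \<eta> \<le> measure ?P E"
    unfolding E_def using bad_sets by (subst P.prob_compl) auto
  moreover have "E \<in> sets ?P" unfolding E_def using bad_sets by (intro sets.Diff sets.top sets.finite_UN) auto
  moreover have "E \<subseteq> S"
  proof
    fix z assume z: "z \<in> E"
    obtain W b where Wb: "z = (W, b)" by (cases z)
    have "\<exists>i. (W $ i, b $ i) \<in> A k" if "k < N" for k
      using z that unfolding E_def bad_def Wb by auto
    then show "z \<in> S" unfolding Wb by (rule S)
  qed
  ultimately show ?thesis unfolding with_prob_at_least_def by blast
qed

section \<open>Distribution of a single row\<close>

text \<open>Radial projection respects cones, so the share of the cone in the ball is its share on
  the sphere. Unit vectors satisfy the norm bounds trivially; these give the statement the shape of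
  the Gaussian one.\<close>

lemma emeasure_unif_sphere_circ_cone_ge:
  fixes u :: "real^'d"
  assumes t: "0 < t" "t \<le> 1" and u: "norm u = 1" and \<rho>: "\<rho> \<ge> 1"
  shows "ennreal (1/3 * (t/2) ^ (CARD('d) - 1)) \<le> emeasure unif_sphere (circ_cone u t \<inter> {w. 1 \<le> norm w \<and> norm w \<le> \<rho>})"
proof -
  let ?B = "ball (0::real^'d) 1"
  let ?T = "circ_cone u t \<inter> {w. 1 \<le> norm w \<and> norm w \<le> \<rho>}"
  have [measurable]: "?T \<in> sets borel" by measurable
  obtain \<kappa> where \<kappa>: "emeasure lborel (circ_cone u t \<inter> ?B) = ennreal \<kappa> * emeasure lborel ?B"
    and \<kappa>ge: "1/3 * (t/2) ^ (CARD('d) - 1) \<le> \<kappa>"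
    by (rule circ_cone_fraction_ge[OF t u])
  have vol: "\<not> unit_ball_vol (real CARD('d)) \<le> 0"
    using unit_ball_vol_pos[of "real CARD('d)"] by (metis not_le of_nat_0_le_iff)
  have B: "emeasure lborel ?B \<noteq> 0" "emeasure lborel ?B \<noteq> \<top>"
    using emeasure_lborel_ball_finite[of "0::real^'d" 1] vol by (auto simp: emeasure_ball ennreal_eq_0_iff)
  \<comment> \<open>The origin projects to itself and violates \<open>1 \<le> norm w\<close>. It is
    removed as a null set.\<close>
  have sub: "circ_cone u t \<inter> ?B - {0} \<subseteq> ?B \<inter> ((\<lambda>x. x /\<^sub>R norm x) -` ?T)"
    using \<rho> by (auto simp: mem_circ_cone_scaleR)
  have "ennreal (1/3 * (t/2) ^ (CARD('d) - 1)) \<le> ennreal \<kappa>" using \<kappa>ge by (rule ennreal_leI)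
  also have "\<dots> = emeasure lborel (circ_cone u t \<inter> ?B) / emeasure lborel ?B"
    using B by (simp add: \<kappa> mult_divide_eq_ennreal)
  also have "emeasure lborel (circ_cone u t \<inter> ?B) = emeasure lborel (circ_cone u t \<inter> ?B - {0})"
    by (rule emeasure_Diff_null_set[symmetric]) auto
  also have "\<dots> / emeasure lborel ?B \<le> emeasure lborel (?B \<inter> ((\<lambda>x. x /\<^sub>R norm x) -` ?T)) / emeasure lborel ?B"
    using sub by (intro divide_right_mono_ennreal emeasure_mono) (auto intro!: sets.Int measurable_sets_borel[OF _ \<open>?T \<in> sets borel\<close>])
  also have "\<dots> = emeasure unif_sphere ?T"
    by (simp add: unif_sphere_def emeasure_distr)
  finally show ?thesis .
qed

section \<open>Gaussian rows: radial density and norm bounds\<close>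

lemma gauss_row_radial:
  "(gauss_row :: (real^'d) measure) = density lborel (\<lambda>w. ennreal ((1 / sqrt (2 * pi)) ^ CARD('d) * exp (- (norm w)\<^sup>2 / 2)))"
proof -
  have "(\<Prod>j\<in>UNIV. std_normal_density (w $ j)) = (1 / sqrt (2 * pi)) ^ CARD('d) * exp (- (norm w)\<^sup>2 / 2)" for w :: "real^'d"
  proof -
    have "(norm w)\<^sup>2 = (\<Sum>j\<in>UNIV. (w $ j)\<^sup>2)" by (simp add: norm_vec_def L2_set_def sum_nonneg)
    then have "exp (- (norm w)\<^sup>2 / 2) = (\<Prod>j\<in>UNIV. exp (- (w $ j)\<^sup>2 / 2))"
      by (simp add: exp_sum[symmetric] sum_negf sum_divide_distrib)
    then show ?thesis by (simp add: std_normal_density_def prod_dividef power_divide)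
  qed
  then show ?thesis by (simp add: gauss_row_def)
qed

text \<open>The ball lies in the cube of side 2. The normal density is at most
  \<open>1 / sqrt (2 * pi) \<le> 2/5\<close>, so each coordinate contributes at most
  \<open>4/5\<close>, and at least two coordinates give \<open>16/25\<close>.\<close>

lemma emeasure_gauss_row_norm_less_1:
  assumes d: "CARD('d) \<ge> 2"
  shows "emeasure gauss_row {w::real^'d. norm w < 1} \<le> ennreal (16/25)"
proof -
  have std: "(\<integral>\<^sup>+y. ennreal (std_normal_density y) * indicator {-1..1} y \<partial>lborel) \<le> ennreal (4/5)"
  proof -
    have "5/2 \<le> sqrt (2 * pi)"
      using pi_approx(1) by (intro real_le_rsqrt) (simp add: power2_eq_square)
    then have "1 / sqrt (2 * pi) \<le> 2/5" by (simp add: field_simps)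
    moreover have "std_normal_density y \<le> 1 / sqrt (2 * pi)" for y
      by (simp add: std_normal_density_def divide_le_cancel)
    ultimately have "std_normal_density y \<le> 2/5" for y using order_trans by blast
    then have "(\<integral>\<^sup>+y. ennreal (std_normal_density y) * indicator {-1..1} y \<partial>lborel) \<le> (\<integral>\<^sup>+y. ennreal (2/5) * indicator {-1..1::real} y \<partial>lborel)"
      by (intro nn_integral_mono mult_right_mono ennreal_leI) auto
    also have "\<dots> = ennreal (2/5) * ennreal 2" by (simp add: nn_integral_cmult)
    also have "\<dots> = ennreal (4/5)" by (subst ennreal_mult[symmetric]) auto
    finally show ?thesis .
  qed
  have "emeasure gauss_row {w::real^'d. norm w < 1} = (\<integral>\<^sup>+w. indicator {w::real^'d. norm w < 1} w \<partial>gauss_row)"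
    by (rule nn_integral_indicator[symmetric]) (simp add: gauss_row_def)
  also have "\<dots> \<le> (\<integral>\<^sup>+w. (\<Prod>j\<in>UNIV. indicator {-1..1} (w $ j)) \<partial>(gauss_row :: (real^'d) measure))"
  proof (intro nn_integral_mono)
    fix w :: "real^'d"
    show "indicator {w. norm w < 1} w \<le> (\<Prod>j\<in>UNIV. indicator {-1..1} (w $ j) :: ennreal)"
    proof (cases "norm w < 1")
      case True
      then have "\<bar>w $ j\<bar> \<le> 1" for j using component_le_norm_cart[of w j] by linarith
      then have "w $ j \<in> {-1..1}" for j by (auto simp: abs_le_iff minus_le_iff)
      then show ?thesis by (simp add: indicator_def)
    qed simp
  qed
  also have "\<dots> = (\<Prod>j\<in>(UNIV::'d set). \<integral>\<^sup>+y. ennreal (std_normal_density y) * indicator {-1..1} y \<partial>lborel)"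
    by (rule nn_integral_gauss_row_prod) simp
  also have "\<dots> \<le> ennreal (4/5) ^ CARD('d)"
    using std by (simp add: power_mono)
  also have "\<dots> = ennreal ((4/5) ^ CARD('d))" by (simp add: ennreal_power)
  also have "\<dots> \<le> ennreal ((4/5) ^ 2)" using d by (intro ennreal_leI power_decreasing) auto
  also have "\<dots> = ennreal (16/25)" by (simp add: power2_eq_square)
  finally show ?thesis .
qed

lemma nn_integral_gauss_row_norm_sq:
  "(\<integral>\<^sup>+w. ennreal ((norm w)\<^sup>2) \<partial>(gauss_row :: (real^'d) measure)) = of_nat CARD('d)"
proof -
  have [measurable]: "(\<lambda>w::real^'d. w $ j) \<in> borel_measurable borel" for j
    by (intro borel_measurable_continuous_onI continuous_intros)
  have [measurable_cong]: "sets (gauss_row :: (real^'d) measure) = sets borel" by (simp add: gauss_row_def)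
  have mom: "(\<integral>\<^sup>+y. ennreal (std_normal_density y) * ennreal (y\<^sup>2) \<partial>lborel) = 1"
  proof -
    have "has_bochner_integral lborel (\<lambda>y. std_normal_density y * y\<^sup>2) 1"
      using std_normal_moment_even[of 1] by simp
    then have "(\<integral>\<^sup>+y. ennreal (std_normal_density y * y\<^sup>2) \<partial>lborel) = ennreal 1"
      by (intro nn_integral_eq_integrable[THEN iffD2]) (auto simp: has_bochner_integral_iff)
    then show ?thesis by (simp add: ennreal_mult')
  qed
  have "(\<integral>\<^sup>+w. ennreal ((norm w)\<^sup>2) \<partial>(gauss_row :: (real^'d) measure))
      = (\<integral>\<^sup>+w. (\<Sum>j\<in>UNIV. ennreal ((w $ j)\<^sup>2)) \<partial>(gauss_row :: (real^'d) measure))"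
    by (simp add: norm_vec_def L2_set_def sum_nonneg)
  also have "\<dots> = (\<Sum>j\<in>UNIV. \<integral>\<^sup>+w. ennreal ((w $ j)\<^sup>2) \<partial>(gauss_row :: (real^'d) measure))"
    by (rule nn_integral_sum) measurable
  also have "\<dots> = (\<Sum>j\<in>(UNIV::'d set). 1)"
  proof (rule sum.cong[OF refl])
    fix j :: 'd
    \<comment> \<open>A function of one coordinate is padded with ones to a product over all
      coordinates, so that the product rule reduces it to the second moment
      \<open>mom\<close>.\<close>
    have "(\<integral>\<^sup>+w. ennreal ((w $ j)\<^sup>2) \<partial>(gauss_row :: (real^'d) measure))
        = (\<integral>\<^sup>+w. (\<Prod>k\<in>UNIV. if k = j then ennreal ((w $ k)\<^sup>2) else 1) \<partial>(gauss_row :: (real^'d) measure))"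
      by (simp add: prod.delta)
    also have "\<dots> = (\<Prod>k\<in>UNIV. \<integral>\<^sup>+y. ennreal (std_normal_density y) * (if k = j then ennreal (y\<^sup>2) else 1) \<partial>lborel)"
      by (rule nn_integral_gauss_row_prod[where f="\<lambda>k y. if k = j then ennreal (y\<^sup>2) else 1"]) measurable
    also have "\<dots> = 1"
    proof (rule prod.neutral, intro ballI)
      fix k
      show "(\<integral>\<^sup>+y. ennreal (std_normal_density y) * (if k = j then ennreal (y\<^sup>2) else 1) \<partial>lborel) = 1"
        by (cases "k = j") (simp_all add: mom nn_integral_std_normal)
    qed
    finally show "(\<integral>\<^sup>+w. ennreal ((w $ j)\<^sup>2) \<partial>(gauss_row :: (real^'d) measure)) = 1" .
  qed
  finally show ?thesis by simp
qed

text \<open>Markov's inequality for the squared norm, whose mean is \<open>CARD('d)\<close>, gives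
  mass at most \<open>1/9\<close> beyond \<rho>. The open unit ball takes at most
  \<open>16/25\<close>, and more than \<open>1/10\<close> remains.\<close>

lemma measure_gauss_row_annulus_ge:
  assumes d: "CARD('d) \<ge> 2" and \<rho>: "\<rho> \<ge> 3 * sqrt (real CARD('d))"
  shows "1/10 \<le> measure gauss_row {w::real^'d. 1 \<le> norm w \<and> norm w \<le> \<rho>}"
proof -
  interpret prob_space "gauss_row :: (real^'d) measure" by (rule prob_space_gauss_row)
  have [measurable_cong, simp]: "sets (gauss_row :: (real^'d) measure) = sets borel" by (simp add: gauss_row_def)
  have [simp]: "space (gauss_row :: (real^'d) measure) = UNIV" by (simp add: gauss_row_def)
  have "\<rho>\<^sup>2 \<ge> (3 * sqrt (real CARD('d)))\<^sup>2" using \<rho> by (intro power_mono) auto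
  then have \<rho>2: "\<rho>\<^sup>2 \<ge> 9 * real CARD('d)" by (simp add: power_mult_distrib)
  have "0 < 3 * sqrt (real CARD('d))" by simp
  then have \<rho>0: "\<rho> > 0" using \<rho> by linarith
  define p2 where "p2 = prob {w. norm w > \<rho>}"
  have "ennreal (9 * real CARD('d)) * ennreal p2
      = (\<integral>\<^sup>+w. ennreal (9 * real CARD('d)) * indicator {w. norm w > \<rho>} w \<partial>(gauss_row :: (real^'d) measure))"
    by (simp add: nn_integral_cmult emeasure_eq_measure p2_def)
  also have "\<dots> \<le> (\<integral>\<^sup>+w. ennreal ((norm w)\<^sup>2) \<partial>(gauss_row :: (real^'d) measure))"
  proof (intro nn_integral_mono)
    fix w :: "real^'d"
    show "ennreal (9 * real CARD('d)) * indicator {w. norm w > \<rho>} w \<le> ennreal ((norm w)\<^sup>2)"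
    proof (cases "norm w > \<rho>")
      case True
      then have "\<rho>\<^sup>2 \<le> (norm w)\<^sup>2" using \<rho>0 by (intro power_mono) auto
      then show ?thesis using \<rho>2 True by (simp add: ennreal_leI)
    qed simp
  qed
  also have "\<dots> = ennreal (real CARD('d))" by (simp add: nn_integral_gauss_row_norm_sq ennreal_of_nat_eq_real_of_nat)
  finally have "ennreal (9 * real CARD('d) * p2) \<le> ennreal (real CARD('d))"
    by (simp add: ennreal_mult')
  then have "9 * real CARD('d) * p2 \<le> real CARD('d)" by simp
  then have p2: "p2 \<le> 1/9" using d by (simp add: field_simps)
  have p1: "prob {w. norm w < 1} \<le> 16/25"
    using emeasure_gauss_row_norm_less_1[OF d] by (simp add: emeasure_eq_measure)
  have "1 = prob (({w. 1 \<le> norm w \<and> norm w \<le> \<rho>} \<union> {w. norm w < 1}) \<union> {w. norm w > \<rho>})"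
  proof -
    have "({w::real^'d. 1 \<le> norm w \<and> norm w \<le> \<rho>} \<union> {w. norm w < 1}) \<union> {w. norm w > \<rho>} = UNIV" by auto
    then show ?thesis using prob_space by simp
  qed
  also have "\<dots> \<le> prob ({w. 1 \<le> norm w \<and> norm w \<le> \<rho>} \<union> {w. norm w < 1}) + p2"
    unfolding p2_def by (rule measure_Un_le) auto
  also have "\<dots> \<le> (prob {w. 1 \<le> norm w \<and> norm w \<le> \<rho>} + prob {w. norm w < 1}) + p2"
    by (intro add_right_mono measure_Un_le) auto
  finally show ?thesis using p1 p2 by linarith
qed

text \<open>The density restricted to the annulus is still radial, so the cone takes the share
  \<open>\<kappa>\<close> of the annulus mass. The loss of \<open>1/10\<close> against the sphere is
  the factor 10 in the Gaussian width.\<close>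

lemma emeasure_gauss_row_circ_cone_ge:
  fixes u :: "real^'d"
  assumes d: "CARD('d) \<ge> 2" and t: "0 < t" "t \<le> 1" and u: "norm u = 1" and \<rho>: "\<rho> \<ge> 3 * sqrt (real CARD('d))"
  shows "ennreal (1/3 * (t/2) ^ (CARD('d) - 1) / 10) \<le> emeasure gauss_row (circ_cone u t \<inter> {w. 1 \<le> norm w \<and> norm w \<le> \<rho>})"
proof -
  interpret prob_space "gauss_row :: (real^'d) measure" by (rule prob_space_gauss_row)
  have [measurable_cong, simp]: "sets (gauss_row :: (real^'d) measure) = sets borel" by (simp add: gauss_row_def)
  let ?B = "ball (0::real^'d) 1"
  let ?A = "{w::real^'d. 1 \<le> norm w \<and> norm w \<le> \<rho>}"
  define F where "F r = indicator {1..\<rho>} r * ennreal ((1 / sqrt (2 * pi)) ^ CARD('d) * exp (- r\<^sup>2 / 2))" for r :: real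
  have [measurable]: "F \<in> borel_measurable borel" unfolding F_def by measurable
  obtain \<kappa> where \<kappa>B: "emeasure lborel (circ_cone u t \<inter> ?B) = ennreal \<kappa> * emeasure lborel ?B"
    and \<kappa>: "1/3 * (t/2) ^ (CARD('d) - 1) \<le> \<kappa>"
    by (rule circ_cone_fraction_ge[OF t u])
  have FA: "indicator ?A w * ennreal ((1 / sqrt (2 * pi)) ^ CARD('d) * exp (- (norm w)\<^sup>2 / 2)) = F (norm w)" for w :: "real^'d"
    by (simp add: F_def indicator_def)
  have "emeasure gauss_row (circ_cone u t \<inter> ?A) = (\<integral>\<^sup>+w. indicator (circ_cone u t) w * F (norm w) \<partial>lborel)"
    unfolding gauss_row_radial
    by (subst emeasure_density) (auto simp: FA[symmetric] indicator_def intro!: nn_integral_cong)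
  also have "\<dots> = ennreal \<kappa> * (\<integral>\<^sup>+w. F (norm (w::real^'d)) \<partial>lborel)"
    by (rule nn_integral_circ_cone_radial[OF _ \<kappa>B]) simp
  also have "(\<integral>\<^sup>+w. F (norm (w::real^'d)) \<partial>lborel) = emeasure gauss_row ?A"
    unfolding gauss_row_radial
    by (subst emeasure_density) (auto simp: FA[symmetric] mult.commute intro!: nn_integral_cong)
  also have "ennreal \<kappa> * emeasure gauss_row ?A = ennreal (\<kappa> * prob ?A)"
    by (simp add: emeasure_eq_measure ennreal_mult'')
  finally have eq: "emeasure gauss_row (circ_cone u t \<inter> ?A) = ennreal (\<kappa> * prob ?A)" .
  have "(1/3 * (t/2) ^ (CARD('d) - 1)) * (1/10) \<le> \<kappa> * prob ?A"
    using measure_gauss_row_annulus_ge[OF d \<rho>] \<kappa> t by (intro mult_mono) (auto intro: order_trans[OF _ \<kappa>])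
  then show ?thesis unfolding eq by (intro ennreal_leI) simp
qed

section \<open>Good neurons\<close>

text \<open>In use, \<open>\<beta>\<close> is the activation \<gamma> plus the radius of the ball
  around \<open>x\<close>, and \<open>l\<close> is the tolerance left for the bias. Both scale with
  \<open>norm w\<close>, so rows of any length are treated alike.\<close>

definition good_neurons :: "'a::real_inner \<Rightarrow> real \<Rightarrow> real \<Rightarrow> 'a \<Rightarrow> real \<Rightarrow> real \<Rightarrow> ('a \<times> real) set" where
  "good_neurons u t \<rho> x \<beta> l = {(w, b). w \<in> circ_cone u t \<and> 1 \<le> norm w \<and> norm w \<le> \<rho> \<and>
     \<beta> * norm w \<le> w \<bullet> x + b \<and> w \<bullet> x + b \<le> (\<beta> + l) * norm w}"

lemma sets_good_neurons:
  "good_neurons u t \<rho> (x::'a::euclidean_space) \<beta> l \<in> sets (borel \<Otimes>\<^sub>M borel)"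
proof -
  have "good_neurons u t \<rho> x \<beta> l = {z \<in> space (borel \<Otimes>\<^sub>M borel). fst z \<in> circ_cone u t \<and> 1 \<le> norm (fst z) \<and> norm (fst z) \<le> \<rho> \<and>
     \<beta> * norm (fst z) \<le> fst z \<bullet> x + snd z \<and> fst z \<bullet> x + snd z \<le> (\<beta> + l) * norm (fst z)}"
    by (auto simp: good_neurons_def space_pair_measure)
  also have "\<dots> \<in> sets (borel \<Otimes>\<^sub>M borel)" by measurable
  finally show ?thesis .
qed

text \<open>For a fixed \<open>w\<close> in the truncated cone the admissible biases form an
  interval of length \<open>l * norm w \<ge> l\<close>. Its ends lie within
  \<open>R * norm w \<le> L\<close> of zero because \<open>w \<bullet> x\<close> is nonnegative and
  \<open>\<beta> + l \<le> R\<close>. So the conditional probability is at least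
  \<open>l / (2 * L)\<close>.\<close>

lemma measure_good_neurons_ge:
  fixes x u :: "real^'d"
  assumes G: "prob_space G" "sets G = sets borel" and L: "L > 0" and R: "R > 0"
    and x: "norm x \<le> R" and \<beta>: "\<beta> \<ge> 0" "l \<ge> 0" "\<beta> + l \<le> R"
    and pos: "\<And>w. w \<in> circ_cone u t \<Longrightarrow> 0 \<le> w \<bullet> x"
    and P: "P \<ge> 0" "ennreal P \<le> emeasure G (circ_cone u t \<inter> {w. 1 \<le> norm w \<and> norm w \<le> L / R})"
  shows "P * (l / (2 * L)) \<le> measure (G \<Otimes>\<^sub>M uniform_measure lborel {-L..L}) (good_neurons u t (L / R) x \<beta> l)"
proof -
  let ?U = "uniform_measure lborel {-L..L}"
  let ?A = "good_neurons u t (L / R) x \<beta> l"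
  let ?T = "circ_cone u t \<inter> {w. 1 \<le> norm w \<and> norm w \<le> L / R}"
  interpret G: prob_space G by (rule G)
  interpret U: prob_space ?U using L by (rule prob_space_uniform_interval)
  interpret Q: pair_prob_space G ?U ..
  note [measurable_cong, simp] = G(2)
  have [measurable]: "?T \<in> sets G" by simp
  have A: "?A \<in> sets (G \<Otimes>\<^sub>M ?U)"
    using sets_good_neurons[of u t "L / R" x \<beta> l] by (simp cong: sets_pair_measure_cong)
  have slice: "ennreal (l / (2 * L)) * indicator ?T w \<le> emeasure ?U (Pair w -` ?A)" for w
  proof (cases "w \<in> ?T")
    case True
    then have w: "w \<in> circ_cone u t" "1 \<le> norm w" "norm w \<le> L / R" by auto
    have RL: "R * norm w \<le> L" using w R by (simp add: field_simps)
    have wx: "0 \<le> w \<bullet> x" "w \<bullet> x \<le> R * norm w"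
      using pos[OF w(1)] norm_cauchy_schwarz[of w x] mult_left_mono[OF x, of "norm w"] by (auto simp: mult.commute)
    have eq: "Pair w -` ?A = {\<beta> * norm w - w \<bullet> x .. (\<beta> + l) * norm w - w \<bullet> x}"
      using w by (auto simp: good_neurons_def)
    have "(\<beta> + l) * norm w \<le> R * norm w" "0 \<le> \<beta> * norm w" using \<beta> by (auto intro: mult_right_mono)
    then have sub: "{-L..L} \<inter> {\<beta> * norm w - w \<bullet> x .. (\<beta> + l) * norm w - w \<bullet> x} = {\<beta> * norm w - w \<bullet> x .. (\<beta> + l) * norm w - w \<bullet> x}"
      using RL wx by auto
    have "l * 1 \<le> l * norm w" using w \<beta> by (intro mult_left_mono) auto
    then have "l / (2 * L) \<le> l * norm w / (2 * L)" using L by (intro divide_right_mono) auto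
    then have "ennreal (l / (2 * L)) \<le> ennreal (l * norm w) / ennreal (2 * L)"
      using L \<beta> by (simp add: divide_ennreal ennreal_leI)
    also have "\<dots> = emeasure lborel {\<beta> * norm w - w \<bullet> x .. (\<beta> + l) * norm w - w \<bullet> x} / emeasure lborel {-L..L}"
      using L \<beta> by (simp add: algebra_simps)
    also have "\<dots> = emeasure lborel ({-L..L} \<inter> Pair w -` ?A) / emeasure lborel {-L..L}"
      unfolding eq sub ..
    also have "\<dots> = emeasure ?U (Pair w -` ?A)"
      by (rule emeasure_uniform_measure[symmetric]) (auto simp: eq)
    finally show ?thesis using True by simp
  qed simp
  have "ennreal (P * (l / (2 * L))) = ennreal (l / (2 * L)) * ennreal P"
    using P L \<beta> by (subst ennreal_mult[symmetric]) (auto simp: mult.commute)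
  also have "\<dots> \<le> ennreal (l / (2 * L)) * emeasure G ?T" using P by (intro mult_left_mono) auto
  also have "\<dots> = (\<integral>\<^sup>+w. ennreal (l / (2 * L)) * indicator ?T w \<partial>G)" by (simp add: nn_integral_cmult)
  also have "\<dots> \<le> (\<integral>\<^sup>+w. emeasure ?U (Pair w -` ?A) \<partial>G)" by (intro nn_integral_mono slice)
  also have "\<dots> = emeasure (G \<Otimes>\<^sub>M ?U) ?A" using A by (simp add: U.emeasure_pair_measure_alt)
  finally show ?thesis by (simp add: Q.emeasure_eq_measure)
qed

text \<open>Good neurons yield triangular features. The assumption \<open>gap\<close> is the budget:
  the gain of \<open>circ_cone_separates\<close> has to pay for the activation, the two radii and
  the tolerance of the bias.\<close>

lemma lin_sep_margin_relu_layer: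
  fixes x :: "nat \<Rightarrow> real^'d" and W :: "real^'d^'n" and b :: "real^'n" and d R \<delta> \<gamma> :: real
  assumes d: "d \<ge> 2" and R: "R > 0" and \<delta>: "\<delta> > 0" and \<gamma>: "\<gamma> > 0" and ne: "Xp \<union> Xm \<noteq> {}"
    and ball: "\<And>y. y \<in> Xp \<union> Xm \<Longrightarrow> norm y \<le> R"
    and sorted: "\<And>k j. k < j \<Longrightarrow> j < N \<Longrightarrow> norm (x j) \<le> norm (x k)"
    and xR: "\<And>k. k < N \<Longrightarrow> norm (x k) \<le> R"
    and sep: "\<And>k j. k < N \<Longrightarrow> j < N \<Longrightarrow> pos k \<noteq> pos j \<Longrightarrow> \<delta> \<le> dist (x k) (x j)"
    and gap: "\<And>k j. k < N \<Longrightarrow> j < N \<Longrightarrow> pos k \<noteq> pos j \<Longrightarrow>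
       \<gamma> + r k + r j + l \<le> (dist (x k) (x j))\<^sup>2 / (2 * R * d) * (1 + (dist (x k) (x j))\<^sup>2 / (32 * R\<^sup>2))"
    and small: "\<And>k. k < N \<Longrightarrow> \<gamma> + r k + l \<le> R"
    and u: "\<And>k. k < N \<Longrightarrow> x k \<noteq> 0 \<Longrightarrow> u k = sgn (x k)"
    and Xp: "Xp \<subseteq> (\<Union>k\<in>{k. k < N \<and> pos k}. cball (x k) (r k))"
    and Xm: "Xm \<subseteq> (\<Union>k\<in>{k. k < N \<and> \<not> pos k}. cball (x k) (r k))"
    and upos: "\<And>k w. k < N \<Longrightarrow> w \<in> circ_cone (u k) t \<Longrightarrow> 0 \<le> w \<bullet> x k"
    and t: "t = (1 - 1/d) * (\<delta> / (2 * R))"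
    and good: "\<And>k. k < N \<Longrightarrow> \<exists>i. (W $ i, b $ i) \<in> good_neurons (u k) t \<rho> (x k) (\<gamma> + r k) l"
  shows "lin_sep_margin (margin_M R \<gamma> N) (relu_layer W b ` Xp) (relu_layer W b ` Xm)"
proof -
  obtain \<nu> where \<nu>: "\<And>k. k < N \<Longrightarrow> (W $ \<nu> k, b $ \<nu> k) \<in> good_neurons (u k) t \<rho> (x k) (\<gamma> + r k) l"
    using good by metis
  \<comment> \<open>Only data of the class of centre \<open>k\<close> is kept, so that its points
    satisfy the norm bound \<open>R\<close>.\<close>
  define C where "C k = (if pos k then Xp else Xm) \<inter> cball (x k) (r k)" for k
  define w where "w k = W $ \<nu> k" for k
  have g: "w k \<in> circ_cone (u k) t" "1 \<le> norm (w k)" "(\<gamma> + r k) * norm (w k) \<le> w k \<bullet> x k + b $ \<nu> k"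
     "w k \<bullet> x k + b $ \<nu> k \<le> (\<gamma> + r k + l) * norm (w k)" if "k < N" for k
    using \<nu>[OF that] by (auto simp: good_neurons_def w_def)
  have relu: "relu_layer W b y $ \<nu> k = max 0 (w k \<bullet> y + b $ \<nu> k)" for y k
    by (simp add: relu_layer_def matrix_vector_mul_component w_def)
  have near: "\<bar>w k \<bullet> y - w k \<bullet> x j\<bar> \<le> r j * norm (w k)" if "y \<in> C j" for y j k
  proof -
    have "\<bar>w k \<bullet> (y - x j)\<bar> \<le> norm (w k) * norm (y - x j)" by (rule Cauchy_Schwarz_ineq2)
    also have "\<dots> \<le> norm (w k) * r j" using that by (intro mult_left_mono) (auto simp: C_def dist_norm norm_minus_commute)
    finally show ?thesis by (simp add: inner_diff_right mult.commute)
  qed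
  show ?thesis
  proof (rule lin_sep_margin_of_triangular_features[where C=C and pos=pos and \<nu>=\<nu> and \<rho>="\<lambda>k. norm (w k)", OF R \<gamma> ne])
    show "Xp \<subseteq> (\<Union>k\<in>{k. k < N \<and> pos k}. C k)" "Xm \<subseteq> (\<Union>k\<in>{k. k < N \<and> \<not> pos k}. C k)"
      using Xp Xm by (auto simp: C_def)
    show "1 \<le> norm (w k)" if "k < N" for k using g(2)[OF that] .
    show "0 \<le> relu_layer W b y $ \<nu> k" for y k by (simp add: relu)
    \<comment> \<open>One \<open>R\<close> bounds the inner product; the other bounds the bias,
      since \<open>w k \<bullet> x k\<close> is nonnegative.\<close>
    show "relu_layer W b y $ \<nu> k \<le> 2 * R * norm (w k)" if j: "j < N" and k: "k < N" and y: "y \<in> C j" for j k y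
    proof -
      have "norm y \<le> R" using y ball by (auto simp: C_def split: if_splits)
      then have "w k \<bullet> y \<le> R * norm (w k)"
        using norm_cauchy_schwarz[of "w k" y] mult_left_mono[of "norm y" R "norm (w k)"] by (auto simp: mult.commute)
      moreover have "(\<gamma> + r k + l) * norm (w k) \<le> R * norm (w k)" using small[OF k] by (intro mult_right_mono) auto
      ultimately show ?thesis using g(4)[OF k] upos[OF k g(1)[OF k]] R by (simp add: relu)
    qed
    show "\<gamma> * norm (w k) \<le> relu_layer W b y $ \<nu> k" if k: "k < N" and y: "y \<in> C k" for k y
      using near[OF y, of k] g(3)[OF k] by (simp add: relu algebra_simps)
    show "relu_layer W b y $ \<nu> k = 0" if kj: "k < j" and j: "j < N" and op: "pos j \<noteq> pos k" and y: "y \<in> C j" for j k y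
    proof -
      have k: "k < N" using kj j by simp
      have D: "\<delta> \<le> dist (x k) (x j)" using sep[OF k j] op by simp
      have "x k \<noteq> 0"
      proof
        assume "x k = 0"
        then have "x j = 0" using sorted[OF kj j] by simp
        then show False using D \<delta> \<open>x k = 0\<close> by simp
      qed
      then have "w k \<in> circ_cone (sgn (x k)) ((1 - 1/d) * (\<delta> / (2 * R)))" using g(1)[OF k] u[OF k] t by simp
      then have "norm (w k) * ((dist (x k) (x j))\<^sup>2 / (2 * R * d) * (1 + (dist (x k) (x j))\<^sup>2 / (32 * R\<^sup>2))) \<le> w k \<bullet> x k - w k \<bullet> x j"
        using d sorted[OF kj j] xR[OF k] \<delta> D by (rule circ_cone_separates)
      moreover have "norm (w k) * (\<gamma> + r k + r j + l) \<le> norm (w k) * ((dist (x k) (x j))\<^sup>2 / (2 * R * d) * (1 + (dist (x k) (x j))\<^sup>2 / (32 * R\<^sup>2)))"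
        using gap[OF k j] op by (intro mult_left_mono) auto
      ultimately have "norm (w k) * (\<gamma> + r k + r j + l) \<le> w k \<bullet> x k - w k \<bullet> x j" by linarith
      then have "w k \<bullet> y + b $ \<nu> k \<le> 0"
        using near[OF y, of k] g(4)[OF k] by (simp add: algebra_simps)
      then show ?thesis by (simp add: relu)
    qed
  qed
qed

text \<open>The sequence \<open>(1 - 1/(m+1)) ^ (m+1)\<close> increases, by Bernoulli's inequality,
  and starts at \<open>1/4\<close>.\<close>

lemma one_le_four_mult_power:
  assumes "m \<ge> 1"
  shows "1 \<le> 4 * (real m / (real m + 1)) ^ (m + 1)"
  using assms
proof (induction m rule: dec_induct)
  case base
  show ?case by (simp add: power2_eq_square)
next
  case (step m)
  define a where "a = real m / (real m + 1)"
  \<comment> \<open>The relative increment of the base: passing from \<open>m\<close> to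
    \<open>m + 1\<close> multiplies \<open>a\<close> by \<open>1 + e\<close>.\<close>
  define e where "e = 1 / (real m * (real m + 2))"
  have m: "real m \<ge> 1" using step by simp
  have e0: "e \<ge> 0" by (simp add: e_def)
  have mm: "real m * real m + real m * 2 > 0" using m by (intro add_pos_pos) auto
  have b: "(real m + 1) / (real m + 2) = a * (1 + e)"
  proof -
    have "1 + e = (real m * (real m + 2) + 1) / (real m * (real m + 2))"
      using m unfolding e_def by (subst add_divide_distrib) auto
    also have "real m * (real m + 2) + 1 = (real m + 1) * (real m + 1)" by (simp add: algebra_simps)
    finally show ?thesis using m by (simp add: a_def)
  qed
  have "1 + real (m + 1) * e \<le> (1 + e) ^ (m + 1)"
    using e0 by (intro Bernoulli_inequality) linarith
  moreover have "(real m + 2) / (real m + 1) \<le> 1 + real (m + 1) * e"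
    using m mm by (simp add: e_def field_simps)
  ultimately have "(real m + 2) / (real m + 1) \<le> (1 + e) ^ (m + 1)" by linarith
  then have "1 \<le> (1 + e) ^ (m + 1) * ((real m + 1) / (real m + 2))"
    using m by (simp add: field_simps)
  then have "4 * a ^ (m + 1) * 1 \<le> 4 * a ^ (m + 1) * ((1 + e) ^ (m + 1) * ((real m + 1) / (real m + 2)))"
    using m by (intro mult_left_mono) (auto simp: a_def)
  also have "\<dots> = 4 * ((a * (1 + e)) ^ (m + 1) * ((real m + 1) / (real m + 2)))"
    by (simp only: power_mult_distrib mult.assoc)
  also have "\<dots> = 4 * ((real m + 1) / (real m + 2)) ^ (m + 2)"
    unfolding b[symmetric] by (simp only: power_add power_one_right power2_eq_square mult.assoc)
  finally have "1 \<le> 4 * ((real m + 1) / (real m + 2)) ^ (m + 2)"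
    using step.IH unfolding a_def by linarith
  moreover have "real (Suc m) / (real (Suc m) + 1) = (real m + 1) / (real m + 2)" "Suc m + 1 = m + 2"
    by (simp_all add: add_ac)
  ultimately show ?case by (simp only:)
qed

text \<open>The right-hand side is the cone bound times the share of good biases. With
  \<open>s = \<delta> / (2 * R)\<close> the comparison uses \<open>s\<^sup>2 \<le> s\<close> and the
  preceding lemma; the \<open>1/3\<close> of the ellipsoid cancels the 3 in the bias
  tolerance.\<close>

lemma success_prob_le:
  fixes R \<delta> L :: real
  assumes d: "d \<ge> 2" and R: "R > 0" and \<delta>: "\<delta> > 0" "\<delta> \<le> 2 * R" and L: "L > 0"
  shows "R / (8 * (real d - 1) * L) * (\<delta>\<^sup>2 / (8 * R\<^sup>2)) ^ d
     \<le> 1/3 * ((1 - 1 / real d) * (\<delta> / (2 * R)) / 2) ^ (d - 1) * ((3 * \<delta>\<^sup>2 / (8 * R * real d)) / (2 * L))"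
proof -
  define m where "m = d - 1"
  have dm: "d = m + 1" "m \<ge> 1" using d by (auto simp: m_def)
  define s where "s = \<delta> / (2 * R)"
  have s: "0 < s" "s \<le> 1" using R \<delta> by (auto simp: s_def)
  have \<delta>s: "\<delta> = 2 * R * s" using R by (simp add: s_def)
  have "R / (8 * (real d - 1) * L) * (\<delta>\<^sup>2 / (8 * R\<^sup>2)) ^ d = R * s\<^sup>2 / (16 * real m * L) * (s\<^sup>2 / 2) ^ m"
    using R dm(2) L by (simp add: dm(1) \<delta>s power_mult_distrib field_simps)
  also have "\<dots> \<le> R * s\<^sup>2 / (16 * real m * L) * (s / 2) ^ m"
  proof -
    have "s\<^sup>2 \<le> s" using s by (simp add: power2_eq_square mult_left_le)
    then show ?thesis using R L s by (intro mult_left_mono power_mono) auto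
  qed
  also have "\<dots> = (R * s\<^sup>2 / (16 * real m * L) * (s / 2) ^ m) * 1" by simp
  \<comment> \<open>One of the \<open>m + 1\<close> inserted factors turns the denominator
    \<open>m\<close> into \<open>d\<close>; the others become the power of
    \<open>1 - 1/d\<close>.\<close>
  also have "\<dots> \<le> (R * s\<^sup>2 / (16 * real m * L) * (s / 2) ^ m) * (4 * (real m / (real m + 1)) ^ (m + 1))"
    using R L s one_le_four_mult_power[OF dm(2)] by (intro mult_left_mono) auto
  also have "\<dots> = 1/3 * ((real m / (real m + 1)) ^ m * (s / 2) ^ m) * ((3 * \<delta>\<^sup>2 / (8 * R * (real m + 1))) / (2 * L))"
  proof -
    have "(R * s\<^sup>2 / (16 * M * L) * z) * (4 * (M / K * v)) = 1/3 * (v * z) * ((3 * \<delta>\<^sup>2 / (8 * R * K)) / (2 * L))"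
      if "M > 0" "K > 0" for M K v z
      using that R L by (simp add: \<delta>s field_simps power2_eq_square)
    from this[of "real m" "real m + 1" "(real m / (real m + 1)) ^ m" "(s / 2) ^ m"] show ?thesis
      using dm(2) by simp
  qed
  also have "(real m / (real m + 1)) ^ m * (s / 2) ^ m = ((1 - 1 / real d) * (\<delta> / (2 * R)) / 2) ^ (d - 1)"
  proof -
    have "real m / (real m + 1) = 1 - 1 / real d" by (simp add: dm(1) field_simps)
    then show ?thesis by (simp add: power_mult_distrib[symmetric] s_def dm(1))
  qed
  finally show ?thesis by (simp add: dm(1) add.commute)
qed

lemma obtain_decreasing_enumeration:
  fixes f :: "'i \<Rightarrow> real"
  assumes "finite I"
  obtains e where "bij_betw e {..<card I} I" "\<And>i j. i < j \<Longrightarrow> j < card I \<Longrightarrow> f (e j) \<le> f (e i)"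
proof -
  obtain xs where xs: "set xs = I" "distinct xs" using finite_distinct_list[OF assms] by blast
  define ys where "ys = sort_key (\<lambda>x. - f x) xs"
  have ys: "set ys = I" "distinct ys" "length ys = card I"
    using xs distinct_card[of xs] by (auto simp: ys_def)
  have "sorted (map (\<lambda>x. - f x) ys)" by (simp add: ys_def)
  then have "f (ys ! j) \<le> f (ys ! i)" if "i < j" "j < card I" for i j
    using that sorted_nth_mono[of "map (\<lambda>x. - f x) ys" i j] by (simp add: ys(3))
  moreover have "bij_betw ((!) ys) {..<card I} I" using bij_betw_nth[OF ys(2)] ys by simp
  ultimately show ?thesis using that by blast
qed

section \<open>Covers by balls\<close>

text \<open>The term \<open>3 * \<delta>\<^sup>2 / (8 * R * real CARD('d))\<close> is the bias
  tolerance \<open>l\<close>. The bound by \<open>R\<close> keeps admissible biases within range;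
  the pairwise inequality is the budget \<open>gap\<close>. The free index type admits both tagged
  points and numbered centres.\<close>

definition separating_cover :: "real \<Rightarrow> real \<Rightarrow> real \<Rightarrow> (real^'d) set \<Rightarrow> (real^'d) set \<Rightarrow> 'i set \<Rightarrow>
    ('i \<Rightarrow> real^'d) \<Rightarrow> ('i \<Rightarrow> bool) \<Rightarrow> ('i \<Rightarrow> real) \<Rightarrow> bool" where
  "separating_cover R \<delta> \<gamma> Xp Xm I x pos r \<longleftrightarrow>
     (\<forall>k\<in>I. norm (x k) \<le> R \<and> 0 \<le> r k \<and> \<gamma> + r k + 3 * \<delta>\<^sup>2 / (8 * R * real CARD('d)) \<le> R) \<and>
     (\<forall>k\<in>I. \<forall>j\<in>I. pos k \<noteq> pos j \<longrightarrow> \<delta> \<le> dist (x k) (x j) \<and>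
        \<gamma> + r k + r j + 3 * \<delta>\<^sup>2 / (8 * R * real CARD('d))
          \<le> (dist (x k) (x j))\<^sup>2 / (2 * R * real CARD('d)) * (1 + (dist (x k) (x j))\<^sup>2 / (32 * R\<^sup>2))) \<and>
     Xp \<subseteq> (\<Union>k\<in>{k\<in>I. pos k}. cball (x k) (r k)) \<and>
     Xm \<subseteq> (\<Union>k\<in>{k\<in>I. \<not> pos k}. cball (x k) (r k))"

lemma separating_cover_reindex:
  assumes "separating_cover R \<delta> \<gamma> Xp Xm I x pos r" and "e ` J = I"
  shows "separating_cover R \<delta> \<gamma> Xp Xm J (x \<circ> e) (pos \<circ> e) (r \<circ> e)"
  using assms unfolding separating_cover_def by (auto simp: subset_iff)

lemma cone_sine_bounds:
  fixes d R \<delta> :: real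
  assumes "d \<ge> 2" "R > 0" "0 < \<delta>" "\<delta> \<le> 2 * R"
  shows "0 < (1 - 1 / d) * (\<delta> / (2 * R))" "(1 - 1 / d) * (\<delta> / (2 * R)) \<le> 1"
proof -
  have *: "0 < 1 - 1 / d" "1 - 1 / d \<le> 1" "0 < \<delta> / (2 * R)" "\<delta> / (2 * R) \<le> 1" using assms by auto
  show "0 < (1 - 1 / d) * (\<delta> / (2 * R))" by (rule mult_pos_pos[OF *(1,3)])
  show "(1 - 1 / d) * (\<delta> / (2 * R)) \<le> 1" by (rule mult_le_one[OF *(2) less_imp_le[OF *(3)] *(4)])
qed

text \<open>The probabilistic and the deterministic half meet here, after sorting the centres by
  norm. \<open>G\<close> and the cone bound \<open>P\<close> stay abstract, so that spherical and
  Gaussian rows share the argument.\<close>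

lemma with_prob_sep_event:
  fixes M :: "(real^'d^'n) measure" and x :: "'i \<Rightarrow> real^'d"
  assumes iid: "iid_rows M G" and d: "CARD('d) \<ge> 2" and R: "R > 0" and \<delta>: "\<delta> > 0" "\<delta> \<le> 2 * R"
    and L: "L > 0" and \<gamma>: "\<gamma> > 0" and \<eta>: "\<eta> > 0"
    and ne: "Xp \<union> Xm \<noteq> {}" and ball: "\<And>y. y \<in> Xp \<union> Xm \<Longrightarrow> norm y \<le> R"
    and I: "finite I" and cover: "separating_cover R \<delta> \<gamma> Xp Xm I x pos r"
    and P: "P \<ge> 0" "\<And>u. norm u = 1 \<Longrightarrow> ennreal P \<le>
       emeasure G (circ_cone u ((1 - 1 / real CARD('d)) * (\<delta> / (2 * R))) \<inter> {w. 1 \<le> norm w \<and> norm w \<le> L / R})"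
    and q: "q > 0" "q \<le> P * (3 * \<delta>\<^sup>2 / (8 * R * real CARD('d)) / (2 * L))"
    and n: "real CARD('n) \<ge> ln (real (card I) / \<eta>) / q"
  shows "with_prob_at_least (M \<Otimes>\<^sub>M unif_bias L) (1 - \<eta>) (sep_event (margin_M R \<gamma> (card I)) Xp Xm)"
proof -
  define N where "N = card I"
  define l where "l = 3 * \<delta>\<^sup>2 / (8 * R * real CARD('d))"
  define t where "t = (1 - 1 / real CARD('d)) * (\<delta> / (2 * R))"
  obtain e where e: "bij_betw e {..<N} I" "\<And>i j. i < j \<Longrightarrow> j < N \<Longrightarrow> norm (x (e j)) \<le> norm (x (e i))"
    using obtain_decreasing_enumeration[OF I, of "\<lambda>i. norm (x i)"] unfolding N_def by blast
  define y where "y = x \<circ> e"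
  define ps where "ps = pos \<circ> e"
  define s where "s = r \<circ> e"
  have cov: "separating_cover R \<delta> \<gamma> Xp Xm {..<N} y ps s"
    unfolding y_def ps_def s_def using cover e(1) by (intro separating_cover_reindex) (auto simp: bij_betw_def)
  obtain k0 :: 'd where True by simp
  \<comment> \<open>A zero centre has no direction, and any unit vector serves. It never has to
    silence a later centre of the other class, which would be zero too, against the
    separation.\<close>
  define u where "u k = (if y k = 0 then axis k0 1 else sgn (y k))" for k
  have u1: "norm (u k) = 1" for k by (simp add: u_def norm_sgn)
  have upos: "0 \<le> w \<bullet> y k" if "w \<in> circ_cone (u k) t" for w k
  proof (cases "y k = 0")
    case False
    have "0 < t" "t \<le> 1" unfolding t_def using d R \<delta> by (intro cone_sine_bounds; simp)+
    then have "t\<^sup>2 \<le> 1" by (simp add: power_le_one)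
    then have "0 \<le> sqrt (1 - t\<^sup>2) * norm w" by simp
    then have "0 \<le> sgn (y k) \<bullet> w" using that False unfolding circ_cone_def u_def by auto
    then show ?thesis using False by (simp add: sgn_div_norm inner_commute zero_le_mult_iff)
  qed simp
  have l0: "l \<ge> 0" using R by (simp add: l_def)
  have c: "norm (y k) \<le> R" "0 \<le> s k" "\<gamma> + s k + l \<le> R" if "k < N" for k
    using cov that unfolding separating_cover_def l_def by auto
  have N0: "N > 0" using ne cov by (auto simp: separating_cover_def)
  show ?thesis unfolding N_def[symmetric]
  proof (rule with_prob_all_events_hit[where A="\<lambda>k. good_neurons (u k) t (L / R) (y k) (\<gamma> + s k) l" and q=q and N=N, OF iid L])
    show "q \<le> measure (G \<Otimes>\<^sub>M uniform_measure lborel {- L..L}) (good_neurons (u k) t (L / R) (y k) (\<gamma> + s k) l)" if k: "k < N" for k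
    proof -
      have "q \<le> P * (l / (2 * L))" using q by (simp add: l_def)
      also have "\<dots> \<le> measure (G \<Otimes>\<^sub>M uniform_measure lborel {- L..L}) (good_neurons (u k) t (L / R) (y k) (\<gamma> + s k) l)"
        using iid c[OF k] \<gamma> l0 P(1) P(2)[OF u1]
        by (intro measure_good_neurons_ge L R upos) (auto simp: iid_rows_def t_def)
      finally show ?thesis .
    qed
    show "(W, b) \<in> sep_event (margin_M R \<gamma> N) Xp Xm"
      if good: "\<And>k. k < N \<Longrightarrow> \<exists>i. (W $ i, b $ i) \<in> good_neurons (u k) t (L / R) (y k) (\<gamma> + s k) l" for W :: "real^'d^'n" and b
    proof -
      have "lin_sep_margin (margin_M R \<gamma> N) (relu_layer W b ` Xp) (relu_layer W b ` Xm)"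
      proof (rule lin_sep_margin_relu_layer[where d="real CARD('d)" and x=y and pos=ps and r=s and l=l and u=u and t=t,
            OF _ R \<delta>(1) \<gamma> ne ball _ _ _ _ _ _ _ _ upos t_def good])
        show "norm (y j) \<le> norm (y k)" if "k < j" "j < N" for k j using e(2)[OF that] by (simp add: y_def)
      qed (use cov d c in \<open>auto simp: separating_cover_def l_def u_def\<close>)
      then show ?thesis by (simp add: sep_event_def)
    qed
  qed (use q \<eta> n N0 in \<open>auto simp: N_def sets_good_neurons\<close>)
qed

section \<open>The case of an empty class\<close>

lemma lin_sep_margin_bounded_empty:
  fixes S :: "(real^'n) set"
  assumes "bounded S"
  shows "lin_sep_margin m S {}" "lin_sep_margin m {} S"
proof -
  obtain B where B: "\<And>s. s \<in> S \<Longrightarrow> norm s \<le> B" using assms unfolding bounded_iff by blast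
  obtain i :: 'n where True by simp
  define a :: "real^'n" where "a = axis i 1"
  have a: "norm a = 1" by (simp add: a_def)
  then have a0: "a \<noteq> 0" by auto
  have as: "\<bar>a \<bullet> s\<bar> \<le> B" if "s \<in> S" for s
    using Cauchy_Schwarz_ineq2[of a s] B[OF that] a by simp
  show "lin_sep_margin m S {}" unfolding lin_sep_margin_def
  \<comment> \<open>The offset pushes the hyperplane beyond the bounded set by more than any
    prescribed margin.\<close>
  proof (intro exI[of _ a] exI[of _ "B + \<bar>m\<bar> + 1"] conjI ballI a0)
    fix s assume "s \<in> S" with as[of s] show "a \<bullet> s + (B + \<bar>m\<bar> + 1) > 0" by linarith
  next
    fix s assume "s \<in> S \<union> {}" with as[of s] show "m \<le> \<bar>a \<bullet> s + (B + \<bar>m\<bar> + 1)\<bar> / norm a" by (simp add: a)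
  qed simp
  show "lin_sep_margin m {} S" unfolding lin_sep_margin_def
  proof (intro exI[of _ a] exI[of _ "- (B + \<bar>m\<bar> + 1)"] conjI ballI a0)
    fix s assume "s \<in> S" with as[of s] show "a \<bullet> s + - (B + \<bar>m\<bar> + 1) < 0" by linarith
  next
    fix s assume "s \<in> {} \<union> S" with as[of s] show "m \<le> \<bar>a \<bullet> s + - (B + \<bar>m\<bar> + 1)\<bar> / norm a" by (simp add: a)
  qed simp
qed

lemma bounded_relu_layer:
  assumes "\<And>x. x \<in> X \<Longrightarrow> norm x \<le> R"
  shows "bounded (relu_layer W b ` X)"
proof -
  have "continuous_on (cball 0 R) (relu_layer W b)"
    unfolding relu_layer_def matrix_mult_dot by (simp, intro continuous_intros)
  then have "bounded (relu_layer W b ` cball 0 R)"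
    by (intro compact_imp_bounded compact_continuous_image) auto
  moreover have "relu_layer W b ` X \<subseteq> relu_layer W b ` cball 0 R" using assms by auto
  ultimately show ?thesis by (rule bounded_subset)
qed

lemma with_prob_sep_event_empty:
  fixes M :: "(real^'d^'n) measure"
  assumes iid: "iid_rows M G" and L: "L > 0" and \<eta>: "\<eta> > 0" and "Xp = {} \<or> Xm = {}"
    and ball: "\<And>x. x \<in> Xp \<union> Xm \<Longrightarrow> norm x \<le> R"
  shows "with_prob_at_least (M \<Otimes>\<^sub>M unif_bias L) (1 - \<eta>) (sep_event m Xp Xm)"
proof -
  interpret M: prob_space M using iid by (rule iid_rows_prob_space)
  interpret B: prob_space "unif_bias L :: (real^'n) measure" using L by (rule prob_space_unif_bias)
  interpret P: pair_prob_space M "unif_bias L :: (real^'n) measure" ..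
  have "sep_event m Xp Xm = (UNIV :: ((real^'d^'n) \<times> (real^'n)) set)"
  proof -
    have "bounded (relu_layer W b ` Xp)" "bounded (relu_layer W b ` Xm)" for W :: "real^'d^'n" and b
      using ball by (auto intro!: bounded_relu_layer[where R=R])
    then have "lin_sep_margin m (relu_layer W b ` Xp) (relu_layer W b ` Xm)" for W :: "real^'d^'n" and b
      using assms(4) lin_sep_margin_bounded_empty by (metis image_empty)
    then show ?thesis by (auto simp: sep_event_def)
  qed
  then show ?thesis
    unfolding with_prob_at_least_def using \<eta> P.prob_space
    by (intro bexI[of _ "space (M \<Otimes>\<^sub>M unif_bias L)"]) auto
qed

text \<open>Each point is its own ball of radius 0, tagged by its class. Activation and bias
  tolerance add up to \<open>\<delta>\<^sup>2 / (2 * R * d)\<close>, the leading gain at distance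
  \<delta>.\<close>

lemma separating_cover_finite:
  fixes Xp Xm :: "(real^'d) set"
  assumes d: "CARD('d) \<ge> 2" and R: "R > 0" and \<delta>: "\<delta> > 0" "\<delta> \<le> 2 * R"
    and ball: "\<And>x. x \<in> Xp \<union> Xm \<Longrightarrow> norm x \<le> R" and sep: "delta_separated \<delta> Xp Xm"
  shows "separating_cover R \<delta> (\<delta>\<^sup>2 / (8 * R * real CARD('d))) Xp Xm (Xp \<times> {True} \<union> Xm \<times> {False}) fst snd (\<lambda>_. 0)"
proof -
  let ?d = "real CARD('d)"
  have d0: "?d \<ge> 2" using d by simp
  have sum: "\<delta>\<^sup>2 / (8 * R * ?d) + 3 * \<delta>\<^sup>2 / (8 * R * ?d) = \<delta>\<^sup>2 / (2 * R * ?d)"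
    using R by (simp add: field_simps)
  have "\<delta>\<^sup>2 \<le> (2 * R)\<^sup>2" using \<delta> by (intro power_mono) auto
  also have "\<dots> = 2 * R\<^sup>2 * 2" by (simp add: power2_eq_square)
  also have "\<dots> \<le> 2 * R\<^sup>2 * ?d" using d0 by (intro mult_left_mono) auto
  finally have small: "\<delta>\<^sup>2 / (2 * R * ?d) \<le> R" using R d0 by (simp add: field_simps power2_eq_square)
  have gap: "\<delta>\<^sup>2 / (2 * R * ?d) \<le> D\<^sup>2 / (2 * R * ?d) * (1 + D\<^sup>2 / (32 * R\<^sup>2))" if "\<delta> \<le> D" for D
  proof -
    have "\<delta>\<^sup>2 / (2 * R * ?d) \<le> D\<^sup>2 / (2 * R * ?d)"
      using that \<delta> R by (intro divide_right_mono power_mono) auto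
    also have "\<dots> \<le> D\<^sup>2 / (2 * R * ?d) * (1 + D\<^sup>2 / (32 * R\<^sup>2))"
      using R mult_left_mono[of 1 "1 + D\<^sup>2 / (32 * R\<^sup>2)" "D\<^sup>2 / (2 * R * ?d)"] by simp
    finally show ?thesis .
  qed
  have sep': "\<delta> \<le> dist a b" if "a \<in> Xp \<and> b \<in> Xm \<or> a \<in> Xm \<and> b \<in> Xp" for a b
    using sep that by (auto simp: delta_separated_def dist_commute)
  show ?thesis
    unfolding separating_cover_def add_0_right sum
    using small ball gap[OF sep'] sep' by (auto simp: sum)
qed

text \<open>Over the common denominator \<open>64 * R ^ 3 * d\<close> the activation and the
  tolerance use 28 of the 32 units of the leading gain \<open>R\<^sup>2 * D\<^sup>2\<close>. The
  other 4 units pay for one radius, and the second-order gain \<open>D\<^sup>2 * D\<^sup>2\<close>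
  pays for the other.\<close>

lemma radius_gap:
  fixes D R \<delta> d :: real
  assumes R: "R > 0" and d: "d > 0" and \<delta>: "\<delta> > 0" "\<delta> \<le> D" "D \<le> 2 * R"
    and r: "r1 \<le> D\<^sup>2 * \<delta>\<^sup>2 / (64 * R ^ 3 * d)" "r2 \<le> D\<^sup>2 * \<delta>\<^sup>2 / (64 * R ^ 3 * d)"
  shows "\<delta>\<^sup>2 / (16 * R * d) + r1 + r2 + 3 * \<delta>\<^sup>2 / (8 * R * d) \<le> D\<^sup>2 / (2 * R * d) * (1 + D\<^sup>2 / (32 * R\<^sup>2))"
proof -
  define K where "K = 64 * R ^ 3 * d"
  have K: "K > 0" using R d by (simp add: K_def)
  have \<delta>D: "\<delta>\<^sup>2 \<le> D\<^sup>2" using \<delta> by (intro power_mono) auto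
  have "D\<^sup>2 \<le> (2 * R)\<^sup>2" using \<delta> by (intro power_mono) auto
  then have DR: "D\<^sup>2 \<le> 4 * R\<^sup>2" by (simp add: power_mult_distrib)
  have "D\<^sup>2 * \<delta>\<^sup>2 \<le> D\<^sup>2 * D\<^sup>2" "D\<^sup>2 * \<delta>\<^sup>2 \<le> D\<^sup>2 * (4 * R\<^sup>2)" "R\<^sup>2 * \<delta>\<^sup>2 \<le> R\<^sup>2 * D\<^sup>2"
    by (rule mult_left_mono[OF \<delta>D] mult_left_mono[OF order_trans[OF \<delta>D DR]], simp)+
  then have main: "4 * (R\<^sup>2 * \<delta>\<^sup>2) + D\<^sup>2 * \<delta>\<^sup>2 + D\<^sup>2 * \<delta>\<^sup>2 + 24 * (R\<^sup>2 * \<delta>\<^sup>2) \<le> 32 * (R\<^sup>2 * D\<^sup>2) + D\<^sup>2 * D\<^sup>2"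
    by (simp add: algebra_simps)
  have "\<delta>\<^sup>2 / (16 * R * d) = 4 * (R\<^sup>2 * \<delta>\<^sup>2) / K" "3 * \<delta>\<^sup>2 / (8 * R * d) = 24 * (R\<^sup>2 * \<delta>\<^sup>2) / K"
    "D\<^sup>2 / (2 * R * d) * (1 + D\<^sup>2 / (32 * R\<^sup>2)) = (32 * (R\<^sup>2 * D\<^sup>2) + D\<^sup>2 * D\<^sup>2) / K"
    using R d by (simp_all add: K_def field_simps power2_eq_square power3_eq_cube)
  moreover have "4 * (R\<^sup>2 * \<delta>\<^sup>2) / K + r1 + r2 + 24 * (R\<^sup>2 * \<delta>\<^sup>2) / K
     \<le> (4 * (R\<^sup>2 * \<delta>\<^sup>2) + D\<^sup>2 * \<delta>\<^sup>2 + D\<^sup>2 * \<delta>\<^sup>2 + 24 * (R\<^sup>2 * \<delta>\<^sup>2)) / K"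
    using r unfolding K_def[symmetric] add_divide_distrib by linarith
  moreover have "\<dots> \<le> (32 * (R\<^sup>2 * D\<^sup>2) + D\<^sup>2 * D\<^sup>2) / K"
    using main K by (intro divide_right_mono) auto
  ultimately show ?thesis by linarith
qed

text \<open>The centres lie in convex hulls of data, hence in the ball of radius \<open>R\<close>,
  and have distance at most \<open>2 * R\<close>. This caps each radius at
  \<open>\<delta>\<^sup>2 / (16 * R * d)\<close>, which settles the budget of a single centre;
  \<open>radius_gap\<close> settles that of a pair.\<close>

lemma separating_cover_mutual_complexity:
  fixes Xp Xm :: "(real^'d) set"
  assumes d: "CARD('d) \<ge> 2" and R: "R > 0" and \<delta>: "\<delta> > 0" "\<delta> \<le> 2 * R"
    and ball: "\<And>x. x \<in> Xp \<union> Xm \<Longrightarrow> norm x \<le> R" and ne: "Xp \<noteq> {}" "Xm \<noteq> {}"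
    and mc: "mutual_complexity \<delta> (64 * \<delta> powi (-2) * R ^ 3 * real CARD('d)) Xp Xm N"
  obtains I :: "(nat \<times> bool) set" and x pos r where "finite I" "card I = N"
    "separating_cover R \<delta> (\<delta>\<^sup>2 / (16 * R * real CARD('d))) Xp Xm I x pos r"
proof -
  let ?d = "real CARD('d)"
  let ?\<mu> = "64 * \<delta> powi (-2) * R ^ 3 * ?d"
  have d0: "?d \<ge> 2" using d by simp
  have \<mu>: "D\<^sup>2 / ?\<mu> = D\<^sup>2 * \<delta>\<^sup>2 / (64 * R ^ 3 * ?d)" for D
    using \<delta> by (simp add: power_int_minus field_simps)
  obtain Np Nm cp cm rp rm where N: "Np + Nm = N"
    and r0: "\<forall>i<Np. rp i \<ge> 0" "\<forall>j<Nm. rm j \<ge> 0"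
    and Xp: "Xp \<subseteq> (\<Union>i<Np. cball (cp i) (rp i))" and Xm: "Xm \<subseteq> (\<Union>j<Nm. cball (cm j) (rm j))"
    and cp: "\<forall>i<Np. cp i \<in> convex hull (Xp \<inter> cball (cp i) (rp i))"
    and cm: "\<forall>j<Nm. cm j \<in> convex hull (Xm \<inter> cball (cm j) (rm j))"
    and rp: "\<forall>i<Np. \<forall>j<Nm. rp i \<le> (dist (cp i) (cm j))\<^sup>2 / ?\<mu>"
    and rm: "\<forall>j<Nm. \<forall>i<Np. rm j \<le> (dist (cm j) (cp i))\<^sup>2 / ?\<mu>"
    and sepc: "delta_separated \<delta> (cp ` {..<Np}) (cm ` {..<Nm})"
    using mc unfolding mutual_complexity_def by (elim exE conjE) (rule that)
  have hull: "norm c \<le> R" if "c \<in> convex hull (X \<inter> S)" "X \<subseteq> Xp \<union> Xm" for c X S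
  proof -
    have "convex hull (X \<inter> S) \<subseteq> cball 0 R" using that ball by (intro hull_minimal) auto
    then show ?thesis using that by auto
  qed
  have cpR: "norm (cp i) \<le> R" if "i < Np" for i using hull[of "cp i" Xp] cp that by auto
  have cmR: "norm (cm j) \<le> R" if "j < Nm" for j using hull[of "cm j" Xm] cm that by auto
  \<comment> \<open>A radius is bounded only through centres of the other class, so there must be
    one.\<close>
  have Np0: "0 < Np" "0 < Nm" using ne Xp Xm by (auto intro: gr0I)
  have D: "\<delta> \<le> dist (cp i) (cm j)" "dist (cp i) (cm j) \<le> 2 * R" if "i < Np" "j < Nm" for i j
    using sepc that cpR[OF that(1)] cmR[OF that(2)] norm_triangle_ineq4[of "cp i" "cm j"]
    by (auto simp: delta_separated_def dist_norm)
  have gap: "\<delta>\<^sup>2 / (16 * R * ?d) + rp i + rm j + 3 * \<delta>\<^sup>2 / (8 * R * ?d)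
      \<le> (dist (cp i) (cm j))\<^sup>2 / (2 * R * ?d) * (1 + (dist (cp i) (cm j))\<^sup>2 / (32 * R\<^sup>2))" if "i < Np" "j < Nm" for i j
    using D[OF that] rp rm that R \<delta> d0 unfolding \<mu> by (intro radius_gap) (auto simp: dist_commute)
  have rsmall: "D\<^sup>2 / ?\<mu> \<le> \<delta>\<^sup>2 / (16 * R * ?d)" if "0 \<le> D" "D \<le> 2 * R" for D
  proof -
    have "D\<^sup>2 * \<delta>\<^sup>2 \<le> (2 * R)\<^sup>2 * \<delta>\<^sup>2" using that by (intro mult_right_mono power_mono) auto
    then have "D\<^sup>2 * \<delta>\<^sup>2 / (64 * R ^ 3 * ?d) \<le> (2 * R)\<^sup>2 * \<delta>\<^sup>2 / (64 * R ^ 3 * ?d)"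
      using R by (intro divide_right_mono) auto
    also have "\<dots> = \<delta>\<^sup>2 / (16 * R * ?d)" using R by (simp add: field_simps power2_eq_square power3_eq_cube)
    finally show ?thesis unfolding \<mu> .
  qed
  have rpS: "rp i \<le> \<delta>\<^sup>2 / (16 * R * ?d)" if i: "i < Np" for i
  proof -
    have "rp i \<le> (dist (cp i) (cm 0))\<^sup>2 / ?\<mu>" using rp i Np0(2) by blast
    also have "\<dots> \<le> \<delta>\<^sup>2 / (16 * R * ?d)" by (rule rsmall[OF zero_le_dist D(2)[OF i Np0(2)]])
    finally show ?thesis .
  qed
  have rmS: "rm j \<le> \<delta>\<^sup>2 / (16 * R * ?d)" if j: "j < Nm" for j
  proof -
    have "rm j \<le> (dist (cp 0) (cm j))\<^sup>2 / ?\<mu>" using rm j Np0(1) by (subst dist_commute) blast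
    also have "\<dots> \<le> \<delta>\<^sup>2 / (16 * R * ?d)" by (rule rsmall[OF zero_le_dist D(2)[OF Np0(1) j]])
    finally show ?thesis .
  qed
  have "\<delta>\<^sup>2 \<le> (2 * R)\<^sup>2" using \<delta> by (intro power_mono) auto
  also have "\<dots> = 2 * R\<^sup>2 * 2" by (simp add: power2_eq_square)
  also have "\<dots> \<le> 2 * R\<^sup>2 * ?d" using d0 by (intro mult_left_mono) auto
  finally have "\<delta>\<^sup>2 / (2 * R * ?d) \<le> R" using R d0 by (simp add: field_simps power2_eq_square)
  moreover have "\<delta>\<^sup>2 / (16 * R * ?d) + \<delta>\<^sup>2 / (16 * R * ?d) + 3 * \<delta>\<^sup>2 / (8 * R * ?d) = \<delta>\<^sup>2 / (2 * R * ?d)"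
    using R by (simp add: field_simps)
  ultimately have small: "\<delta>\<^sup>2 / (16 * R * ?d) + \<rho> + 3 * \<delta>\<^sup>2 / (8 * R * ?d) \<le> R"
    if "\<rho> \<le> \<delta>\<^sup>2 / (16 * R * ?d)" for \<rho> using that by linarith
  \<comment> \<open>Tagged numbers rather than the centres themselves: repeated centres count
    separately, and exactly \<open>N\<close> indices result.\<close>
  define I where "I = {..<Np} \<times> {True} \<union> {..<Nm} \<times> {False}"
  define x where "x = (\<lambda>(i, b). if b then cp i else cm i)"
  define r where "r = (\<lambda>(i, b). if b then rp i else rm i)"
  show thesis
  proof (rule that)
    show "finite I" by (simp add: I_def)
    show "card I = N" unfolding I_def by (subst card_Un_disjoint) (auto simp: N)
    show "separating_cover R \<delta> (\<delta>\<^sup>2 / (16 * R * ?d)) Xp Xm I x snd r"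
      unfolding separating_cover_def
    proof (intro conjI ballI impI)
      fix k assume "k \<in> I"
      then show "norm (x k) \<le> R" "0 \<le> r k" "\<delta>\<^sup>2 / (16 * R * ?d) + r k + 3 * \<delta>\<^sup>2 / (8 * R * ?d) \<le> R"
        using cpR cmR r0 small[OF rpS] small[OF rmS] by (auto simp: I_def x_def r_def)
    next
      fix k j assume "k \<in> I" "j \<in> I" "snd k \<noteq> snd j"
      then show "\<delta> \<le> dist (x k) (x j)"
        using D(1) by (auto simp: I_def x_def dist_commute)
    next
      fix k j assume "k \<in> I" "j \<in> I" "snd k \<noteq> snd j"
      then consider i i' where "k = (i, True)" "j = (i', False)" "i < Np" "i' < Nm"
        | i i' where "k = (i', False)" "j = (i, True)" "i < Np" "i' < Nm"
        by (auto simp: I_def)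
      then show "\<delta>\<^sup>2 / (16 * R * ?d) + r k + r j + 3 * \<delta>\<^sup>2 / (8 * R * ?d)
          \<le> (dist (x k) (x j))\<^sup>2 / (2 * R * ?d) * (1 + (dist (x k) (x j))\<^sup>2 / (32 * R\<^sup>2))"
      proof cases
        case (1 i i')
        then show ?thesis using gap[of i i'] by (simp add: x_def r_def)
      next
        case (2 i i')
        have "\<delta>\<^sup>2 / (16 * R * ?d) + r k + r j + 3 * \<delta>\<^sup>2 / (8 * R * ?d)
            = \<delta>\<^sup>2 / (16 * R * ?d) + rp i + rm i' + 3 * \<delta>\<^sup>2 / (8 * R * ?d)" using 2 by (simp add: r_def)
        moreover have "dist (x k) (x j) = dist (cp i) (cm i')" using 2 by (simp add: x_def dist_commute)
        ultimately show ?thesis using gap[OF 2(3,4)] by (simp only:)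
      qed
    next
      show "Xp \<subseteq> (\<Union>k\<in>{k \<in> I. snd k}. cball (x k) (r k))"
      proof
        fix z assume "z \<in> Xp"
        then obtain i where "i < Np" "z \<in> cball (cp i) (rp i)" using Xp by blast
        then show "z \<in> (\<Union>k\<in>{k \<in> I. snd k}. cball (x k) (r k))"
          by (intro UN_I[of "(i, True)"]) (auto simp: I_def x_def r_def)
      qed
      show "Xm \<subseteq> (\<Union>k\<in>{k \<in> I. \<not> snd k}. cball (x k) (r k))"
      proof
        fix z assume "z \<in> Xm"
        then obtain i where "i < Nm" "z \<in> cball (cm i) (rm i)" using Xm by blast
        then show "z \<in> (\<Union>k\<in>{k \<in> I. \<not> snd k}. cball (x k) (r k))"
          by (intro UN_I[of "(i, False)"]) (auto simp: I_def x_def r_def)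
      qed
    qed
  qed
qed

section \<open>Assembly for spherical and Gaussian rows\<close>

theorem theorem1p1:
  fixes Xp Xm :: "(real^'d) set"
    and R \<delta> L \<eta> \<gamma> p :: real and N :: nat
  assumes d2: "CARD('d) \<ge> 2"
    and R: "R > 0" and delta: "\<delta> > 0"
    and ballp: "\<forall>x\<in>Xp. norm x \<le> R" and ballm: "\<forall>x\<in>Xm. norm x \<le> R"
    and sep: "delta_separated \<delta> Xp Xm"
    and Ngamma: "(finite Xp \<and> finite Xm \<and> N = card Xp + card Xm
                    \<and> \<gamma> = \<delta>\<^sup>2 / (8 * R * real CARD('d)))
              \<or> (\<not> (finite Xp \<and> finite Xm)
                    \<and> mutual_complexity \<delta> (64 * \<delta> powi (-2) * R ^ 3 * real CARD('d)) Xp Xm N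
                    \<and> \<gamma> = \<delta>\<^sup>2 / (16 * R * real CARD('d)))"
    and lam: "L > 0"
    and p: "p = R / (8 * (real CARD('d) - 1) * L) * (\<delta>\<^sup>2 / (8 * R\<^sup>2)) ^ CARD('d)"
    and eta: "0 < \<eta>" "\<eta> < 1"
  shows
    "(real CARD('n) \<ge> ln (real N / \<eta>) / p \<and> L \<ge> R \<longrightarrow>
        with_prob_at_least ((sphere_rows :: (real^'d^'n) measure) \<Otimes>\<^sub>M unif_bias L) (1 - \<eta>)
          (sep_event (margin_M R \<gamma> N) Xp Xm))
   \<and> (real CARD('n) \<ge> 10 * ln (real N / \<eta>) / p \<and> L \<ge> 3 * R * sqrt (real CARD('d)) \<longrightarrow>
        with_prob_at_least ((gauss_matrix :: (real^'d^'n) measure) \<Otimes>\<^sub>M unif_bias L) (1 - \<eta>)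
          (sep_event (margin_M R \<gamma> N) Xp Xm))"
proof -
  let ?d = "real CARD('d)"
  let ?t = "(1 - 1 / ?d) * (\<delta> / (2 * R))"
  define P where "P = 1/3 * (?t / 2) ^ (CARD('d) - 1)"
  have ball: "norm x \<le> R" if "x \<in> Xp \<union> Xm" for x using that ballp ballm by auto
  have \<gamma>: "\<gamma> > 0" using Ngamma R delta by auto
  \<comment> \<open>Both row distributions at once: \<open>c\<close> is the factor by which their
    cone probability may fall short of \<open>P\<close>.\<close>
  have main: "with_prob_at_least (M \<Otimes>\<^sub>M unif_bias L) (1 - \<eta>) (sep_event (margin_M R \<gamma> N) Xp Xm)"
    if iid: "iid_rows (M :: (real^'d^'n) measure) G" and c: "0 < c"
      and cone: "\<And>u. norm u = 1 \<Longrightarrow> 0 < ?t \<Longrightarrow> ?t \<le> 1 \<Longrightarrow>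
        ennreal (P * c) \<le> emeasure G (circ_cone u ?t \<inter> {w. 1 \<le> norm w \<and> norm w \<le> L / R})"
      and n: "real CARD('n) \<ge> ln (real N / \<eta>) / (p * c)" for M G c
  proof (cases "Xp = {} \<or> Xm = {}")
    case True
    then show ?thesis using iid lam eta(1) ball by (intro with_prob_sep_event_empty)
  next
    case False
    \<comment> \<open>One point of each class forces \<open>\<delta> \<le> 2 * R\<close>, without
      which the sine \<open>?t\<close> might exceed 1.\<close>
    then obtain a b where ab: "a \<in> Xp" "b \<in> Xm" by auto
    have "\<delta> \<le> dist a b" using sep ab by (auto simp: delta_separated_def)
    also have "\<dots> \<le> norm a + norm b" unfolding dist_norm by (rule norm_triangle_ineq4)
    also have "\<dots> \<le> 2 * R" using ball[of a] ball[of b] ab by auto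
    finally have \<delta>2: "\<delta> \<le> 2 * R" .
    have t: "0 < ?t" "?t \<le> 1"
      using d2 R delta \<delta>2 by (intro cone_sine_bounds; simp)+
    have P0: "P > 0"
      unfolding P_def using zero_less_power[OF half_gt_zero[OF t(1)]] by (rule mult_pos_pos[rotated]) simp
    have p0: "p > 0" using d2 R delta lam by (simp add: p)
    have "p \<le> P * (3 * \<delta>\<^sup>2 / (8 * R * ?d) / (2 * L))"
      unfolding p P_def using d2 R delta \<delta>2 lam by (intro success_prob_le) auto
    then have "p * c \<le> P * (3 * \<delta>\<^sup>2 / (8 * R * ?d) / (2 * L)) * c"
      using c by (intro mult_right_mono) auto
    then have pc: "p * c \<le> (P * c) * (3 * \<delta>\<^sup>2 / (8 * R * ?d) / (2 * L))" by (simp only: mult_ac)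
    \<comment> \<open>Polymorphic in the index type, because the two alternatives for
      \<open>N\<close> use different index sets.\<close>
    have step: "with_prob_at_least (M \<Otimes>\<^sub>M unif_bias L) (1 - \<eta>) (sep_event (margin_M R \<gamma> N) Xp Xm)"
      if "finite I" "card I = N" "separating_cover R \<delta> \<gamma> Xp Xm I x pos r"
      for I :: "'i set" and x pos r
      unfolding that(2)[symmetric]
      by (rule with_prob_sep_event[where P="P * c" and q="p * c", OF iid d2 R delta \<delta>2 lam \<gamma> eta(1) _ _ that(1,3)])
         (use P0 c p0 pc n cone[OF _ t] ball False that(2) in auto)
    show ?thesis using Ngamma
    proof (elim disjE conjE)
      assume *: "finite Xp" "finite Xm" "N = card Xp + card Xm" "\<gamma> = \<delta>\<^sup>2 / (8 * R * ?d)"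
      have "separating_cover R \<delta> \<gamma> Xp Xm (Xp \<times> {True} \<union> Xm \<times> {False}) fst snd (\<lambda>_. 0)"
        unfolding *(4) using d2 R delta \<delta>2 ball sep by (intro separating_cover_finite) auto
      moreover have "card (Xp \<times> {True} \<union> Xm \<times> {False}) = N"
        using * by (subst card_Un_disjoint) auto
      ultimately show ?thesis using * by (intro step) auto
    next
      assume *: "mutual_complexity \<delta> (64 * \<delta> powi (-2) * R ^ 3 * ?d) Xp Xm N" "\<gamma> = \<delta>\<^sup>2 / (16 * R * ?d)"
      show ?thesis
      proof (rule separating_cover_mutual_complexity[OF d2 R delta \<delta>2 ball _ _ *(1)])
        fix I :: "(nat \<times> bool) set" and x pos r
        assume "finite I" "card I = N" "separating_cover R \<delta> (\<delta>\<^sup>2 / (16 * R * ?d)) Xp Xm I x pos r"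
        then show ?thesis unfolding *(2)[symmetric] by (rule step)
      qed (use False in auto)
    qed
  qed
  have "with_prob_at_least ((sphere_rows :: (real^'d^'n) measure) \<Otimes>\<^sub>M unif_bias L) (1 - \<eta>)
          (sep_event (margin_M R \<gamma> N) Xp Xm)"
    if "real CARD('n) \<ge> ln (real N / \<eta>) / p" "L \<ge> R"
  proof (rule main[OF iid_rows_sphere, where c=1])
    show "ennreal (P * 1) \<le> emeasure unif_sphere (circ_cone u ?t \<inter> {w. 1 \<le> norm w \<and> norm w \<le> L / R})"
      if "norm u = 1" "0 < ?t" "?t \<le> 1" for u :: "real^'d"
      using emeasure_unif_sphere_circ_cone_ge[OF that(2,3,1), of "L / R"] \<open>L \<ge> R\<close> R by (simp add: P_def)
  qed (use that in auto)
  moreover have "with_prob_at_least ((gauss_matrix :: (real^'d^'n) measure) \<Otimes>\<^sub>M unif_bias L) (1 - \<eta>)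
          (sep_event (margin_M R \<gamma> N) Xp Xm)"
    if "real CARD('n) \<ge> 10 * ln (real N / \<eta>) / p" "L \<ge> 3 * R * sqrt ?d"
  \<comment> \<open>The mass \<open>1/10\<close> of the annulus becomes the factor 10 in the
    required width.\<close>
  proof (rule main[OF iid_rows_gauss, where c="1/10"])
    show "ennreal (P * (1/10)) \<le> emeasure gauss_row (circ_cone u ?t \<inter> {w. 1 \<le> norm w \<and> norm w \<le> L / R})"
      if "norm u = 1" "0 < ?t" "?t \<le> 1" for u :: "real^'d"
    proof -
      have "3 * sqrt ?d \<le> L / R" using \<open>L \<ge> 3 * R * sqrt ?d\<close> R by (simp add: field_simps)
      then show ?thesis
        using emeasure_gauss_row_circ_cone_ge[OF d2 that(2,3,1), of "L / R"] by (simp add: P_def)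
    qed
  qed (use that in \<open>auto simp: mult.commute\<close>)
  ultimately show ?thesis by blast
qed

end
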